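(* Let $1\le r<k$ be integers. Suppose that $U_r$ consists of all inequivalent binary self-dual $[2r,r]$ codes, i.e. $U_r$ contains exactly one code from every equivalence class of binary self-dual $[2r,r]$ codes. Then the algorithm described in the context (with input set $U_r$ and target dimension $k$) generates all inequivalent binary self-dual $[2k,k]$ codes, i.e. its output $U_k$ contains exactly one code from every equivalence class of binary self-dual $[2k,k]$ codes.
   Context: All codes are binary linear codes; a self-dual code of dimension $k$ has length $2k$. A permutation $\sigma\in S_n$ acts on a code of length $n$ by moving coordinate $i$ to position $\sigma(i)$. Two codes are equivalent ($\cong$) if one is the image of the other under a coordinate permutation; $\mathrm{Aut}(C)=\{\sigma: \sigma(C)=C\}$. Two coordinates $i,j$ of a code $C$ are called equal if $x_i=x_j$ for all $x\in C$. Canonical forms. Let $\Omega_k$ be the set of all binary self-dual codes of dimension $k$. For each $k\ge 2$ a canonical representative map is fixed: a function $\rho:\Omega_k\to\Omega_k$ with $\rho(X)\cong X$ for all $X$, and $\rho(X)=\rho(Y)$ whenever $X\cong Y$; it is assumed to be chosen so that the last two coordinates of every code $\rho(X)$ are not equal. A canonical permutation of $B\in\Omega_k$ is any $\phi\in S_{2k}$ with $\phi(B)=\rho(B)$. Parent test. Given a canonical permutation $\phi_B$ of $B\in\Omega_k$, let $c_1,c_2$ be the coordinates with $\phi_B(c_1)=2k$, $\phi_B(c_2)=2k-1$. The code $B$ passes the parent test if there is $\sigma\in\mathrm{Aut}(B)$ with $\{\sigma(c_1),\sigma(c_2)\}=\{2k-1,2k\}$; equivalently, if there is a canonical permutation $\phi$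 of $B$ with $\{\phi(2k-1),\phi(2k)\}=\{2k-1,2k\}$. Child type codes. Let $A$ be a self-dual $[2k-2,k-1]$ code with a generator matrix $G_A$ in systematic form (i.e. containing the identity matrix $I_{k-1}$ in the columns of some information set). For $a=(a_1,\dots,a_{k-1})\in\mathbb{F}_2^{k-1}$ of odd weight, let $C_0$ be the code of length $2k$ generated by $(G_A\mid a^T\ a^T)$, and let $x\in\mathbb{F}_2^{2k}$ be the vector with $x_{2k-1}=1$, $x_{2k}=0$, whose entries in the information positions of $G_A$ are $a_1,\dots,a_{k-1}$ and whose other entries are $0$. The code $\langle C_0,x\rangle$ is a self-dual $[2k,k]$ code, the child type code of $A$ defined by $a$. Each automorphism $P$ of $A$ (as a permutation matrix) determines the invertible matrix $A_P\in\mathrm{GL}(k-1,2)$ with $G_AP=A_PG_A$, and $\mathrm{Aut}(A)$ acts on the odd-weight vectors of $\mathbb{F}_2^{k-1}$ via $a^T\mapsto A_Pa^T$. $Child(A)$ denotes the set of child type codes of $A$ obtained by taking one representative vector $a$ from each orbit of this action. Algorithm. Input: a nonempty set $U_r$ of binary self-dual $[2r,r]$ codes and an integer $k>r$. Output: a set $U_k$ of self-dual $[2k,k]$ codes. Start with $U_k=\emptyset$ and call Augmentation$(A)$ for every $A\in U_r$, where Augmentation$(A)$ is the recursive procedure: if $\dim A=k$, add $A$ to $U_k$; if $\dim A<k$, compute $Child(A)$, and for every $B\in Child(A)$ that passes the parent test, call Augmentation$(B)$. *)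

theory Defs
  imports
    "Jordan_Normal_Form.VS_Connect"
    "HOL-Combinatorics.Permutations"
    "HOL-Library.Z2"
begin

(* A binary code of length n is a set of vectors in carrier_vec n over the field bit.
   Coordinates are numbered from 0, so the last two coordinates of a code of length 2k
   are 2k-2 and 2k-1. A vector knows its length and a linear code is nonempty, so the
   length of a code, and with it the dimension of a self-dual code, can be read off
   the code. *)
type_synonym code = "bit vec set"

definition linear_code :: "nat \<Rightarrow> nat \<Rightarrow> code \<Rightarrow> bool" where
  "linear_code n k C \<longleftrightarrow>
     VectorSpace.subspace class_ring C (module_vec TYPE(bit) n) \<and>
     vectorspace.dim class_ring ((module_vec TYPE(bit) n)\<lparr>carrier := C\<rparr>) = k"

definition dual_code :: "nat \<Rightarrow> code \<Rightarrow> code" where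
  "dual_code n C = {y \<in> carrier_vec n. \<forall>x\<in>C. scalar_prod x y = 0}"

definition self_dual_codes :: "nat \<Rightarrow> code set" where
  "self_dual_codes k = {C. linear_code (2 * k) k C \<and> dual_code (2 * k) C = C}"

(* Entry i of x becomes entry \<sigma> i of the image. *)
definition permute_vec :: "(nat \<Rightarrow> nat) \<Rightarrow> bit vec \<Rightarrow> bit vec" where
  "permute_vec \<sigma> x = vec (dim_vec x) (\<lambda>j. x $ (Hilbert_Choice.inv \<sigma> j))"

definition permute_code :: "(nat \<Rightarrow> nat) \<Rightarrow> code \<Rightarrow> code" where
  "permute_code \<sigma> C = permute_vec \<sigma> ` C"

definition code_equiv :: "nat \<Rightarrow> code \<Rightarrow> code \<Rightarrow> bool" where
  "code_equiv n C D \<longleftrightarrow> (\<exists>\<sigma>. \<sigma> permutes {..<n} \<and> permute_code \<sigma> C = D)"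

definition code_Aut :: "nat \<Rightarrow> code \<Rightarrow> (nat \<Rightarrow> nat) set" where
  "code_Aut n C = {\<sigma>. \<sigma> permutes {..<n} \<and> permute_code \<sigma> C = C}"

definition equal_coords :: "code \<Rightarrow> nat \<Rightarrow> nat \<Rightarrow> bool" where
  "equal_coords C i j \<longleftrightarrow> (\<forall>x\<in>C. x $ i = x $ j)"

definition canonical_rep_map :: "nat \<Rightarrow> (code \<Rightarrow> code) \<Rightarrow> bool" where
  "canonical_rep_map k \<rho> \<longleftrightarrow>
     (\<forall>X\<in>self_dual_codes k. \<rho> X \<in> self_dual_codes k \<and> code_equiv (2 * k) (\<rho> X) X) \<and>
     (\<forall>X\<in>self_dual_codes k. \<forall>Y\<in>self_dual_codes k.
        code_equiv (2 * k) X Y \<longrightarrow> \<rho> X = \<rho> Y) \<and>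
     (\<forall>X\<in>self_dual_codes k. \<not> equal_coords (\<rho> X) (2 * k - 2) (2 * k - 1))"

definition canonical_perm :: "nat \<Rightarrow> (code \<Rightarrow> code) \<Rightarrow> code \<Rightarrow> (nat \<Rightarrow> nat) \<Rightarrow> bool" where
  "canonical_perm k \<rho> B \<phi> \<longleftrightarrow> \<phi> permutes {..<2 * k} \<and> permute_code \<phi> B = \<rho> B"

definition passes_parent_test :: "nat \<Rightarrow> (nat \<Rightarrow> nat) \<Rightarrow> code \<Rightarrow> bool" where
  "passes_parent_test k \<phi> B \<longleftrightarrow>
     (let c1 = Hilbert_Choice.inv \<phi> (2 * k - 1); c2 = Hilbert_Choice.inv \<phi> (2 * k - 2)
      in \<exists>\<sigma>\<in>code_Aut (2 * k) B. {\<sigma> c1, \<sigma> c2} = {2 * k - 2, 2 * k - 1})"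

(* G is an m x 2m generator matrix of A whose columns at the positions p 0, ..., p (m-1)
   form the identity matrix. *)
definition systematic_generator :: "nat \<Rightarrow> code \<Rightarrow> bit mat \<Rightarrow> (nat \<Rightarrow> nat) \<Rightarrow> bool" where
  "systematic_generator m A G p \<longleftrightarrow>
     G \<in> carrier_mat m (2 * m) \<and>
     vec_space.row_space (2 * m) G = A \<and>
     (\<forall>i<m. p i < 2 * m \<and> col G (p i) = unit_vec m i)"

definition odd_weight_vecs :: "nat \<Rightarrow> bit vec set" where
  "odd_weight_vecs m = {a \<in> carrier_vec m. odd (card {i. i < m \<and> a $ i = 1})}"

(* Here and below m = dim A, so a child has dimension m + 1 and its
   last two coordinates are 2m and 2m + 1. *)

(* The matrix (G | a^T a^T). *)
definition extended_generator :: "nat \<Rightarrow> bit mat \<Rightarrow> bit vec \<Rightarrow> bit mat" where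
  "extended_generator m G a =
     mat m (2 * m + 2) (\<lambda>(i, j). if j < 2 * m then G $$ (i, j) else a $ i)"

definition glue_vec :: "nat \<Rightarrow> (nat \<Rightarrow> nat) \<Rightarrow> bit vec \<Rightarrow> bit vec" where
  "glue_vec m p a = vec (2 * m + 2) (\<lambda>j.
     if j = 2 * m then 1
     else if j = 2 * m + 1 then 0
     else if j \<in> p ` {..<m} then a $ the_inv_into {..<m} p j
     else 0)"

definition child_code :: "nat \<Rightarrow> bit mat \<Rightarrow> (nat \<Rightarrow> nat) \<Rightarrow> bit vec \<Rightarrow> code" where
  "child_code m G p a =
     LinearCombinations.module.span class_ring (module_vec TYPE(bit) (2 * m + 2))
       (insert (glue_vec m p a)
          (vec_space.row_space (2 * m + 2) (extended_generator m G a)))"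

(* With row vectors x, x * perm_mat n \<sigma> is permute_vec \<sigma> x. *)
definition perm_mat :: "nat \<Rightarrow> (nat \<Rightarrow> nat) \<Rightarrow> bit mat" where
  "perm_mat n \<sigma> = mat n n (\<lambda>(i, j). if j = \<sigma> i then 1 else 0)"

(* M ranges over the matrices A_P of the automorphisms P of A, i.e. G P = A_P G. *)
definition Aut_orbit :: "nat \<Rightarrow> code \<Rightarrow> bit mat \<Rightarrow> bit vec \<Rightarrow> bit vec set" where
  "Aut_orbit m A G a = {M *\<^sub>v a | M. M \<in> carrier_mat m m \<and> invertible_mat M \<and>
     (\<exists>\<sigma>\<in>code_Aut (2 * m) A. G * perm_mat (2 * m) \<sigma> = M * G)}"

definition orbit_transversal :: "nat \<Rightarrow> code \<Rightarrow> bit mat \<Rightarrow> bit vec set \<Rightarrow> bool" where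
  "orbit_transversal m A G R \<longleftrightarrow>
     R \<subseteq> odd_weight_vecs m \<and> (\<forall>a\<in>odd_weight_vecs m. \<exists>!b. b \<in> R \<and> b \<in> Aut_orbit m A G a)"

(* S is a possible value of Child(A): it depends on the systematic generator matrix and
   on the orbit representatives that are chosen. *)
definition is_Child :: "nat \<Rightarrow> code \<Rightarrow> code set \<Rightarrow> bool" where
  "is_Child m A S \<longleftrightarrow>
     (\<exists>G p R. systematic_generator m A G p \<and> orbit_transversal m A G R \<and>
        S = child_code m G p ` R)"

(* The set of codes that the call Augmentation(A) adds to U_k, where m = dim A. The choices
   made by the algorithm are given by Child and by the canonical permutations \<phi>. *)
function augmentation ::
  "(code \<Rightarrow> code set) \<Rightarrow> (code \<Rightarrow> nat \<Rightarrow> nat) \<Rightarrow> nat \<Rightarrow> nat \<Rightarrow> code \<Rightarrow> code set" where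
  "augmentation Child \<phi> k m A =
     (if m = k then {A}
      else if m < k then
        (\<Union>B \<in> {B \<in> Child A. passes_parent_test (m + 1) (\<phi> B) B}.
           augmentation Child \<phi> k (m + 1) B)
      else {})"
  by pat_completeness auto
termination by (relation "measure (\<lambda>(Child, \<phi>, k, m, A). k - m)") auto

declare augmentation.simps [simp del]

definition algorithm_output ::
  "(code \<Rightarrow> code set) \<Rightarrow> (code \<Rightarrow> nat \<Rightarrow> nat) \<Rightarrow> nat \<Rightarrow> nat \<Rightarrow> code set \<Rightarrow> code set" where
  "algorithm_output Child \<phi> k r U = (\<Union>A\<in>U. augmentation Child \<phi> k r A)"

definition all_inequivalent_self_dual :: "nat \<Rightarrow> code set \<Rightarrow> bool" where
  "all_inequivalent_self_dual k U \<longleftrightarrow>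
     U \<subseteq> self_dual_codes k \<and>
     (\<forall>C\<in>self_dual_codes k. \<exists>!D. D \<in> U \<and> code_equiv (2 * k) C D)"

end

theory Submission
  imports Defs
begin

text \<open>
  For a self-dual code \<open>A\<close> of length \<open>n\<close> and a vector \<open>w\<close> with \<open>w \<bullet> w = 1\<close>, the vectors
  \<open>(g, g \<bullet> w, g \<bullet> w)\<close> with \<open>g \<in> A\<close>, together with their translates by \<open>(w, 1, 0)\<close>, form a
  self-dual code of length \<open>n + 2\<close>. The child type codes are exactly these codes, and up to
  exchanging the last two coordinates the code depends only on the functional
  \<open>g \<mapsto> g \<bullet> w\<close> on \<open>A\<close>. Conversely, in a self-dual code \<open>B\<close> whose last two coordinates are not
  equal, the words that agree there yield \<open>A\<close>, and a word \<open>(w, 1, 0)\<close> of \<open>B\<close> yields the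
  functional, because it is orthogonal to \<open>B\<close>.

  Hence permutations between children that preserve the last pair of coordinates correspond to
  permutations between the parents that respect the functionals. For one parent these are the
  automorphisms acting on the odd vectors \<open>a\<close>. The parent test says that \<open>B\<close> is the image of its
  canonical form under a permutation that preserves the last pair. So equivalent accepted codes
  are related by such a permutation and coincide, while every canonical form \<open>\<rho> C\<close> is mapped by
  such a permutation to a child of a code in the given list, and this child is accepted.
\<close>

subsection \<open>Binary self-dual codes\<close>

(* Z2 lets simp turn + and * on bit into xor and and, where the ring lemmas no longer apply. *)
declare add_bit_eq_xor [simp del] mult_bit_eq_and [simp del]

text \<open>Expansion in a basis is a bijection between coefficient functions and vectors. Over
  \<open>bit\<close> this turns the dimension of a code into a word count.\<close>

lemma (in vectorspace) card_carrier_eq_power_dim: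
  assumes "finite (carrier K)" "fin_dim"
  shows "card (carrier V) = card (carrier K) ^ dim"
proof -
  obtain B where B: "finite B" "basis B"
    using finite_basis_exists[OF assms(2)] by blast
  have BV: "B \<subseteq> carrier V" using B unfolding basis_def by blast
  have uniq: "\<exists>!a. a \<in> B \<rightarrow>\<^sub>E carrier K \<and> lincomb a B = v" if "v \<in> carrier V" for v
    using basis_criterion[OF B(1) BV] B(2) that by blast
  have "bij_betw (\<lambda>a. lincomb a B) (B \<rightarrow>\<^sub>E carrier K) (carrier V)"
    unfolding bij_betw_def
  proof
    have cl: "lincomb a B \<in> carrier V" if "a \<in> B \<rightarrow>\<^sub>E carrier K" for a
      using that BV by (intro lincomb_closed) auto
    show "inj_on (\<lambda>a. lincomb a B) (B \<rightarrow>\<^sub>E carrier K)"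
      using uniq cl by (intro inj_onI) blast
    show "(\<lambda>a. lincomb a B) ` (B \<rightarrow>\<^sub>E carrier K) = carrier V"
    proof
      show "(\<lambda>a. lincomb a B) ` (B \<rightarrow>\<^sub>E carrier K) \<subseteq> carrier V" using cl by blast
      show "carrier V \<subseteq> (\<lambda>a. lincomb a B) ` (B \<rightarrow>\<^sub>E carrier K)"
      proof
        fix v assume "v \<in> carrier V"
        then obtain a where "a \<in> B \<rightarrow>\<^sub>E carrier K" "lincomb a B = v" using uniq by blast
        then show "v \<in> (\<lambda>a. lincomb a B) ` (B \<rightarrow>\<^sub>E carrier K)" by blast
      qed
    qed
  qed
  then have "card (carrier V) = card (B \<rightarrow>\<^sub>E carrier K)"
    using bij_betw_same_card by metis
  also have "\<dots> = card (carrier K) ^ dim"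
    using B by (simp add: card_PiE dim_basis)
  finally show ?thesis .
qed

lemma UNIV_bit: "(UNIV :: bit set) = {0, 1}"
proof -
  have "x \<in> {0, 1}" for x :: bit by (cases x) simp_all
  then show ?thesis by blast
qed

lemma finite_bit_vecs: "finite (carrier_vec n :: bit vec set)"
proof (rule finite_subset)
  show "carrier_vec n \<subseteq> vec n ` ({..<n} \<rightarrow>\<^sub>E (UNIV :: bit set))"
  proof
    fix x :: "bit vec" assume "x \<in> carrier_vec n"
    then have "x = vec n (restrict (\<lambda>i. x $ i) {..<n})" by (intro eq_vecI) simp_all
    then show "x \<in> vec n ` ({..<n} \<rightarrow>\<^sub>E UNIV)" by (metis UNIV_I image_eqI restrict_PiE_iff)
  qed
  show "finite (vec n ` ({..<n} \<rightarrow>\<^sub>E (UNIV :: bit set)))"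
    unfolding UNIV_bit by (intro finite_imageI finite_PiE) simp_all
qed

text \<open>The only scalars are 0 and 1, which send a vector to zero or to itself, so closure under
  scalars is automatic.\<close>

lemma subspace_bit_iff:
  "VectorSpace.subspace class_ring C (module_vec TYPE(bit) n) \<longleftrightarrow>
     C \<subseteq> carrier_vec n \<and> 0\<^sub>v n \<in> C \<and> (\<forall>x\<in>C. \<forall>y\<in>C. x + y \<in> C)" (is "?L \<longleftrightarrow> ?R")
proof
  interpret vec_space "TYPE(bit)" n .
  show ?R if ?L
  proof -
    interpret submodule class_ring C V using that unfolding subspace_def by auto
    show ?thesis using subset m_closed zero_closed by (auto simp: module_vec_simps)
  qed
  show ?L if R: ?R
  proof -
    have "c \<cdot>\<^sub>v x \<in> C" if "x \<in> C" for c :: bit and x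
    proof (cases c)
      case zero
      have "0 \<cdot>\<^sub>v x = 0\<^sub>v n" using that R by auto
      then show ?thesis using R zero by simp
    next
      case one
      then show ?thesis using that by simp
    qed
    then have "submodule class_ring C V"
      using R module_axioms by (intro submodule.intro) (auto simp: module_vec_simps)
    then show ?thesis using vectorspace_axioms unfolding subspace_def by blast
  qed
qed

lemma card_bit_subspace:
  assumes "VectorSpace.subspace class_ring C (module_vec TYPE(bit) n)"
  shows "card C = 2 ^ vectorspace.dim class_ring ((module_vec TYPE(bit) n)\<lparr>carrier := C\<rparr>)"
proof -
  interpret vec_space "TYPE(bit)" n .
  interpret W: vectorspace class_ring "V\<lparr>carrier := C\<rparr>"
    using subspace_is_vs[OF assms] .
  \<comment> \<open>The code is a finite set that spans itself, which makes it
    finite-dimensional.\<close>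
  have "finite C" using assms finite_bit_vecs finite_subset unfolding subspace_bit_iff by blast
  moreover have "W.span C = C"
    using W.in_own_span[of C] W.span_is_subset2[of C] by auto
  ultimately have "W.fin_dim" unfolding W.fin_dim_def by (intro exI[of _ C]) auto
  then show ?thesis
    using W.card_carrier_eq_power_dim by (simp add: UNIV_bit class_ring_simps numeral_2_eq_2)
qed

lemma bit_add_eq_0_iff: "a + b = 0 \<longleftrightarrow> a = b" for a b :: bit
  by (cases a; cases b) simp_all

lemma bit_vec_add_self: "x \<in> carrier_vec n \<Longrightarrow> x + x = 0\<^sub>v n" for x :: "bit vec"
  by (intro eq_vecI) (simp_all add: bit_add_eq_0_iff)

lemma bit_vec_add_cancel_right:
  "x \<in> carrier_vec n \<Longrightarrow> y \<in> carrier_vec n \<Longrightarrow> x + y + y = x" for x y :: "bit vec"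
  by (simp add: assoc_add_vec[of x n y y] bit_vec_add_self)

lemma mem_dual_code: "y \<in> dual_code n C \<longleftrightarrow> y \<in> carrier_vec n \<and> (\<forall>x\<in>C. x \<bullet> y = 0)"
  unfolding dual_code_def by blast

text \<open>The equation makes membership an orthogonality condition, which is linear; hence it
  alone forces \<open>C\<close> to be a linear code and can stand for "self-dual of length
  \<open>n\<close>" from here on.\<close>

lemma
  assumes "dual_code n C = C"
  shows self_dual_mem: "y \<in> C \<longleftrightarrow> y \<in> carrier_vec n \<and> (\<forall>x\<in>C. x \<bullet> y = 0)"
    and self_dual_carrier: "y \<in> C \<Longrightarrow> y \<in> carrier_vec n"
    and self_dual_orth: "x \<in> C \<Longrightarrow> y \<in> C \<Longrightarrow> x \<bullet> y = 0"
    and self_dual_zero: "0\<^sub>v n \<in> C"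
    and self_dual_add: "x \<in> C \<Longrightarrow> y \<in> C \<Longrightarrow> x + y \<in> C"
proof -
  show mem: "y \<in> C \<longleftrightarrow> y \<in> carrier_vec n \<and> (\<forall>x\<in>C. x \<bullet> y = 0)" for y
    using assms mem_dual_code by blast
  show car: "y \<in> carrier_vec n" if "y \<in> C" for y using mem that by blast
  show "x \<bullet> y = 0" if "x \<in> C" "y \<in> C" for x y using mem that by blast
  show "0\<^sub>v n \<in> C" by (subst mem) (simp add: car)
  show "x + y \<in> C" if "x \<in> C" "y \<in> C"
  proof (subst mem, intro conjI ballI)
    show "x + y \<in> carrier_vec n" using car that by simp
    show "z \<bullet> (x + y) = 0" if z: "z \<in> C" for z
      using \<open>x \<in> C\<close> \<open>y \<in> C\<close> z
      by (simp add: scalar_prod_add_distrib[OF car car car] mem[of x] mem[of y])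
  qed
qed

lemma self_dual_subspace:
  "dual_code n C = C \<Longrightarrow> VectorSpace.subspace class_ring C (module_vec TYPE(bit) n)"
  unfolding subspace_bit_iff
  using self_dual_carrier[of n C] self_dual_zero[of n C] self_dual_add[of n C] by blast

text \<open>Linearity follows from self-duality, and the dimension is the binary logarithm of the
  size. Later arguments check duality and count words instead of computing dimensions.\<close>

lemma self_dual_codes_iff:
  "C \<in> self_dual_codes k \<longleftrightarrow> dual_code (2 * k) C = C \<and> card C = 2 ^ k"
proof
  assume "C \<in> self_dual_codes k"
  then show "dual_code (2 * k) C = C \<and> card C = 2 ^ k"
    using card_bit_subspace unfolding self_dual_codes_def linear_code_def by auto
next
  assume C: "dual_code (2 * k) C = C \<and> card C = 2 ^ k"
  then have "VectorSpace.subspace class_ring C (module_vec TYPE(bit) (2 * k))"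
    using self_dual_subspace by blast
  then show "C \<in> self_dual_codes k"
    using C card_bit_subspace unfolding self_dual_codes_def linear_code_def by simp
qed

subsection \<open>Coordinate permutations\<close>

lemma permute_vec_carrier [simp]: "permute_vec \<sigma> x \<in> carrier_vec n \<longleftrightarrow> x \<in> carrier_vec n"
  unfolding permute_vec_def carrier_vec_def by simp

lemma dim_permute_vec [simp]: "dim_vec (permute_vec \<sigma> x) = dim_vec x"
  by (simp add: permute_vec_def)

lemma index_permute_vec: "j < dim_vec x \<Longrightarrow> permute_vec \<sigma> x $ j = x $ Hilbert_Choice.inv \<sigma> j"
  by (simp add: permute_vec_def)

lemma permutes_inv_less: "\<sigma> permutes {..<n} \<Longrightarrow> j < n \<Longrightarrow> Hilbert_Choice.inv \<sigma> j < (n :: nat)"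
  using permutes_in_image[OF permutes_inv, of \<sigma> "{..<n}" j] by simp

lemma permute_vec_scalar_prod:
  assumes "\<sigma> permutes {..<n}" "x \<in> carrier_vec n" "y \<in> carrier_vec n"
  shows "permute_vec \<sigma> x \<bullet> permute_vec \<sigma> y = x \<bullet> y"
proof -
  have "permute_vec \<sigma> x \<bullet> permute_vec \<sigma> y = (\<Sum>i\<in>{..<n}. x $ Hilbert_Choice.inv \<sigma> i * y $ Hilbert_Choice.inv \<sigma> i)"
    using assms by (simp add: scalar_prod_def index_permute_vec atLeast0LessThan)
  also have "\<dots> = (\<Sum>i\<in>{..<n}. x $ i * y $ i)"
    using sum.permute[OF permutes_inv[OF assms(1)], of "\<lambda>i. x $ i * y $ i"] by (simp add: o_def)
  also have "\<dots> = x \<bullet> y" using assms by (simp add: scalar_prod_def atLeast0LessThan)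
  finally show ?thesis .
qed

lemma permute_vec_comp:
  assumes "\<sigma> permutes {..<n}" "\<tau> permutes {..<n}" "x \<in> carrier_vec n"
  shows "permute_vec (\<sigma> \<circ> \<tau>) x = permute_vec \<sigma> (permute_vec \<tau> x)"
  using assms
  by (intro eq_vecI)
    (simp_all add: index_permute_vec permutes_inv_less o_inv_distrib permutes_bij)

lemma permute_vec_id [simp]: "permute_vec id x = x"
  by (intro eq_vecI) (simp_all add: index_permute_vec)

lemma permute_vec_inv:
  assumes "\<sigma> permutes {..<n}" "x \<in> carrier_vec n"
  shows "permute_vec (Hilbert_Choice.inv \<sigma>) (permute_vec \<sigma> x) = x"
    and "permute_vec \<sigma> (permute_vec (Hilbert_Choice.inv \<sigma>) x) = x"
  using assms permute_vec_comp[of "Hilbert_Choice.inv \<sigma>" n \<sigma> x] permute_vec_comp[of \<sigma> n "Hilbert_Choice.inv \<sigma>" x]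
  by (simp_all add: permutes_inv permutes_inv_o)

lemma permute_code_comp:
  assumes "\<sigma> permutes {..<n}" "\<tau> permutes {..<n}" "C \<subseteq> carrier_vec n"
  shows "permute_code (\<sigma> \<circ> \<tau>) C = permute_code \<sigma> (permute_code \<tau> C)"
  using assms permute_vec_comp[OF assms(1,2)] unfolding permute_code_def image_image
  by (intro image_cong) auto

lemma permute_code_id [simp]: "permute_code id C = C"
  by (simp add: permute_code_def)

lemma permute_code_carrier: "C \<subseteq> carrier_vec n \<Longrightarrow> permute_code \<sigma> C \<subseteq> carrier_vec n"
  by (auto simp: permute_code_def)

lemma permute_code_inv:
  assumes "\<sigma> permutes {..<n}" "C \<subseteq> carrier_vec n"
  shows "permute_code (Hilbert_Choice.inv \<sigma>) (permute_code \<sigma> C) = C"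
  using assms permute_code_comp[of "Hilbert_Choice.inv \<sigma>" n \<sigma> C]
  by (simp add: permutes_inv permutes_inv_o)

lemma permute_vec_inj_on: "\<sigma> permutes {..<n} \<Longrightarrow> inj_on (permute_vec \<sigma>) (carrier_vec n)"
  by (rule inj_on_inverseI[of _ "permute_vec (Hilbert_Choice.inv \<sigma>)"]) (simp add: permute_vec_inv)

lemma permute_code_card:
  assumes "\<sigma> permutes {..<n}" "C \<subseteq> carrier_vec n"
  shows "card (permute_code \<sigma> C) = card C"
  unfolding permute_code_def
  using permute_vec_inj_on[OF assms(1)] assms(2) by (intro card_image) (rule inj_on_subset)

text \<open>Scalar products are invariant, so a word orthogonal to the image is pulled back by the
  inverse of \<open>\<sigma>\<close> to a word orthogonal to \<open>C\<close>.\<close>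

lemma permute_code_self_dual:
  assumes \<sigma>: "\<sigma> permutes {..<n}" and C: "dual_code n C = C"
  shows "dual_code n (permute_code \<sigma> C) = permute_code \<sigma> C"
proof (intro equalityI subsetI)
  fix y assume "y \<in> permute_code \<sigma> C"
  then show "y \<in> dual_code n (permute_code \<sigma> C)"
    unfolding mem_dual_code permute_code_def
    using self_dual_carrier[OF C] self_dual_orth[OF C] permute_vec_scalar_prod[OF \<sigma>] by auto
next
  fix y assume y: "y \<in> dual_code n (permute_code \<sigma> C)"
  let ?y = "permute_vec (Hilbert_Choice.inv \<sigma>) y"
  have car: "y \<in> carrier_vec n" using y unfolding mem_dual_code by blast
  have "x \<bullet> ?y = 0" if "x \<in> C" for x
  proof -
    have "x \<bullet> ?y = permute_vec \<sigma> x \<bullet> permute_vec \<sigma> ?y"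
      using permute_vec_scalar_prod[OF \<sigma>, of x ?y] self_dual_carrier[OF C that] car by simp
    also have "\<dots> = 0"
      using y that unfolding mem_dual_code permute_code_def permute_vec_inv(2)[OF \<sigma> car] by blast
    finally show ?thesis .
  qed
  then have "?y \<in> C" using car self_dual_mem[OF C, of ?y] unfolding permute_vec_carrier by blast
  then show "y \<in> permute_code \<sigma> C"
    unfolding permute_code_def using permute_vec_inv(2)[OF \<sigma> car] by (metis image_eqI)
qed

lemma code_equiv_refl: "code_equiv n C C"
  unfolding code_equiv_def using permutes_id permute_code_id by blast

lemma code_equiv_sym: "code_equiv n C D \<Longrightarrow> C \<subseteq> carrier_vec n \<Longrightarrow> code_equiv n D C"
  unfolding code_equiv_def using permute_code_inv permutes_inv by metis

lemma code_equiv_trans: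
  "code_equiv n C D \<Longrightarrow> code_equiv n D E \<Longrightarrow> C \<subseteq> carrier_vec n \<Longrightarrow> code_equiv n C E"
  unfolding code_equiv_def using permute_code_comp permutes_compose by metis

subsection \<open>Appending two coordinates\<close>

definition extend_vec :: "bit vec \<Rightarrow> bit \<Rightarrow> bit \<Rightarrow> bit vec" where
  "extend_vec x s t = vec (dim_vec x + 2)
     (\<lambda>j. if j < dim_vec x then x $ j else if j = dim_vec x then s else t)"

lemma dim_extend_vec [simp]: "dim_vec (extend_vec x s t) = dim_vec x + 2"
  by (simp add: extend_vec_def)

lemma extend_vec_carrier [simp]:
  "extend_vec x s t \<in> carrier_vec (n + 2) \<longleftrightarrow> x \<in> carrier_vec n"
  "extend_vec x s t \<in> carrier_vec (Suc (Suc n)) \<longleftrightarrow> x \<in> carrier_vec n"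
  unfolding extend_vec_def carrier_vec_def by simp_all

lemma index_extend_vec:
  assumes "x \<in> carrier_vec n"
  shows "j < n \<Longrightarrow> extend_vec x s t $ j = x $ j" "extend_vec x s t $ n = s"
    "extend_vec x s t $ Suc n = t"
  using assms by (simp_all add: extend_vec_def)

lemma extend_vec_eq_iff:
  assumes "x \<in> carrier_vec n" "x' \<in> carrier_vec n"
  shows "extend_vec x s t = extend_vec x' s' t' \<longleftrightarrow> x = x' \<and> s = s' \<and> t = t'"
proof
  assume eq: "extend_vec x s t = extend_vec x' s' t'"
  have "x $ j = x' $ j" if "j < n" for j
    using index_extend_vec(1)[OF assms(1) that] index_extend_vec(1)[OF assms(2) that] eq by metis
  then show "x = x' \<and> s = s' \<and> t = t'"
    using index_extend_vec(2,3)[OF assms(1)] index_extend_vec(2,3)[OF assms(2)] eq assms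
    by (metis carrier_vecD eq_vecI)
qed simp

lemma extend_vec_cases:
  assumes "z \<in> carrier_vec (n + 2)"
  obtains x s t where "x \<in> carrier_vec n" "z = extend_vec x s t"
proof
  show "vec n (\<lambda>j. z $ j) \<in> carrier_vec n" by simp
  show "z = extend_vec (vec n (\<lambda>j. z $ j)) (z $ n) (z $ Suc n)"
    using assms by (intro eq_vecI) (auto simp: extend_vec_def less_Suc_eq)
qed

lemma extend_vec_add:
  assumes "x \<in> carrier_vec n" "x' \<in> carrier_vec n"
  shows "extend_vec x s t + extend_vec x' s' t' = extend_vec (x + x') (s + s') (t + t')"
  using assms by (intro eq_vecI) (auto simp: extend_vec_def)

lemma extend_vec_scalar_prod:
  assumes "x \<in> carrier_vec n" "x' \<in> carrier_vec n"
  shows "extend_vec x s t \<bullet> extend_vec x' s' t' = x \<bullet> x' + s * s' + t * t'"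
  using assms by (simp add: scalar_prod_def extend_vec_def)

lemma permute_extend_vec:
  assumes \<sigma>: "\<sigma> permutes {..<n}" and x: "x \<in> carrier_vec n"
  shows "permute_vec \<sigma> (extend_vec x s t) = extend_vec (permute_vec \<sigma> x) s t"
proof (intro eq_vecI)
  fix j assume "j < dim_vec (extend_vec (permute_vec \<sigma> x) s t)"
  moreover have "Hilbert_Choice.inv \<sigma> j = j" if "\<not> j < n"
    using permutes_not_in[OF permutes_inv[OF \<sigma>]] that by simp
  ultimately show "permute_vec \<sigma> (extend_vec x s t) $ j = extend_vec (permute_vec \<sigma> x) s t $ j"
    using x permutes_inv_less[OF \<sigma>, of j]
    by (cases "j < n") (auto simp: extend_vec_def permute_vec_def)
qed simp

lemma swap_extend_vec:
  assumes "x \<in> carrier_vec n"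
  shows "permute_vec (Transposition.transpose n (Suc n)) (extend_vec x s t) = extend_vec x t s"
  using assms
  by (intro eq_vecI) (auto simp: permute_vec_def extend_vec_def inv_unique_comp transpose_def less_Suc_eq)

subsection \<open>Children\<close>

text \<open>Matrix-free form of a child type code. Its two cosets are written out instead of a span,
  so that membership and size can be computed directly. The glue vector \<open>(w, 1, 0)\<close> is
  the case \<open>g = 0\<close> of the second part.\<close>

definition child_of :: "code \<Rightarrow> bit vec \<Rightarrow> code" where
  "child_of A w = (\<lambda>g. extend_vec g (g \<bullet> w) (g \<bullet> w)) ` A
     \<union> (\<lambda>g. extend_vec (g + w) (g \<bullet> w + 1) (g \<bullet> w)) ` A"

text \<open>Recovers the parent from a child. Unlike in the usual shortening, the deleted pair may
  read 00 or 11.\<close>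

definition shortened :: "nat \<Rightarrow> code \<Rightarrow> code" where
  "shortened n B = {x \<in> carrier_vec n. \<exists>s. extend_vec x s s \<in> B}"

text \<open>The last two entries tell the cosets apart: they agree exactly on the first one. On the
  second one, adding \<open>w\<close> undoes the translation.\<close>

lemma extend_mem_child_of:
  assumes A: "A \<subseteq> carrier_vec n" and w: "w \<in> carrier_vec n" and x: "x \<in> carrier_vec n"
  shows "extend_vec x s t \<in> child_of A w \<longleftrightarrow>
    (if s = t then x \<in> A \<and> s = x \<bullet> w else x + w \<in> A \<and> t = (x + w) \<bullet> w)"
proof -
  have ne: "a + 1 \<noteq> a" for a :: bit by (cases a) simp_all
  have 1: "extend_vec x s t \<in> (\<lambda>g. extend_vec g (g \<bullet> w) (g \<bullet> w)) ` A \<longleftrightarrow>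
      s = t \<and> x \<in> A \<and> s = x \<bullet> w"
    using A x extend_vec_eq_iff[of x n] by (auto simp: image_iff subset_iff)
  have 2: "extend_vec x s t \<in> (\<lambda>g. extend_vec (g + w) (g \<bullet> w + 1) (g \<bullet> w)) ` A \<longleftrightarrow>
      s \<noteq> t \<and> x + w \<in> A \<and> t = (x + w) \<bullet> w" (is "?L \<longleftrightarrow> ?R")
  proof
    assume ?L
    then obtain g where g: "g \<in> A" "x = g + w" "s = g \<bullet> w + 1" "t = g \<bullet> w"
      using A w extend_vec_eq_iff[OF x] by (auto simp: image_iff subset_iff)
    moreover have "x + w = g" using g A w bit_vec_add_cancel_right by blast
    ultimately show ?R using ne by simp
  next
    assume R: ?R
    then have "s = (x + w) \<bullet> w + 1" by (cases s; cases t) simp_all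
    then show ?L
      using R bit_vec_add_cancel_right[OF x w] by (intro image_eqI[of _ _ "x + w"]) simp_all
  qed
  show ?thesis unfolding child_of_def Un_iff 1 2 by auto
qed

lemma child_of_carrier:
  "A \<subseteq> carrier_vec n \<Longrightarrow> w \<in> carrier_vec n \<Longrightarrow> child_of A w \<subseteq> carrier_vec (n + 2)"
  unfolding child_of_def by auto

lemma shortened_child_of:
  assumes "A \<subseteq> carrier_vec n" "w \<in> carrier_vec n"
  shows "shortened n (child_of A w) = A"
proof -
  have "x \<in> A \<longleftrightarrow> x \<in> carrier_vec n \<and> (\<exists>s. extend_vec x s s \<in> child_of A w)" for x
    using assms extend_mem_child_of[OF assms, of x] by auto
  then show ?thesis unfolding shortened_def by blast
qed

text \<open>Both parametrisations by \<open>A\<close> are injective, and their images are disjoint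
  because only the second has distinct last entries. Doubling the size is what raises the dimension
  by one.\<close>

lemma card_child_of:
  assumes A: "A \<subseteq> carrier_vec n" and w: "w \<in> carrier_vec n"
  shows "card (child_of A w) = 2 * card A"
proof -
  have fin: "finite A" using A finite_bit_vecs finite_subset by blast
  have inj1: "inj_on (\<lambda>g. extend_vec g (g \<bullet> w) (g \<bullet> w)) A"
    using A extend_vec_eq_iff by (intro inj_onI) blast
  have inj2: "inj_on (\<lambda>g. extend_vec (g + w) (g \<bullet> w + 1) (g \<bullet> w)) A"
  proof (rule inj_onI)
    fix g h assume "g \<in> A" "h \<in> A"
      and eq: "extend_vec (g + w) (g \<bullet> w + 1) (g \<bullet> w) = extend_vec (h + w) (h \<bullet> w + 1) (h \<bullet> w)"
    then have car: "g \<in> carrier_vec n" "h \<in> carrier_vec n" using A by auto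
    then have "g + w = h + w"
      using eq extend_vec_eq_iff[OF add_carrier_vec[OF car(1) w] add_carrier_vec[OF car(2) w]] by blast
    then show "g = h" using car bit_vec_add_cancel_right w by metis
  qed
  have ne: "a + 1 \<noteq> a" for a :: bit by (cases a) simp_all
  have "(\<lambda>g. extend_vec g (g \<bullet> w) (g \<bullet> w)) ` A
     \<inter> (\<lambda>g. extend_vec (g + w) (g \<bullet> w + 1) (g \<bullet> w)) ` A = {}"
  proof -
    have "extend_vec g (g \<bullet> w) (g \<bullet> w) \<noteq> extend_vec (h + w) (h \<bullet> w + 1) (h \<bullet> w)"
      if "g \<in> A" "h \<in> A" for g h
      using that A w ne extend_vec_eq_iff[of g n "h + w"] by (metis add_carrier_vec subsetD)
    then show ?thesis by blast
  qed
  then show ?thesis unfolding child_of_def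
    by (simp add: card_Un_disjoint fin card_image inj1 inj2)
qed

lemma glue_mem_child_of:
  assumes "dual_code n A = A" "w \<in> carrier_vec n"
  shows "extend_vec w 1 0 \<in> child_of A w"
  using assms self_dual_carrier[OF assms(1)] self_dual_zero[OF assms(1)]
  by (subst extend_mem_child_of[of _ n]) (auto simp: bit_vec_add_self)

text \<open>Orthogonality is a computation on the four combinations of cosets; two words of the
  second coset are orthogonal because \<open>w \<bullet> w = 1\<close>. For maximality, a word
  orthogonal to the child is reduced to one with equal last entries.\<close>

lemma child_of_self_dual:
  assumes A: "dual_code n A = A" and w: "w \<in> carrier_vec n" "w \<bullet> w = 1"
  shows "dual_code (n + 2) (child_of A w) = child_of A w"
proof -
  have sub: "A \<subseteq> carrier_vec n" using self_dual_carrier[OF A] by blast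
  have orth: "u \<bullet> v = 0" if "u \<in> child_of A w" "v \<in> child_of A w" for u v
  proof -
    have *: "extend_vec g (g \<bullet> w) (g \<bullet> w) \<bullet> extend_vec h (h \<bullet> w) (h \<bullet> w) = 0"
      "extend_vec g (g \<bullet> w) (g \<bullet> w) \<bullet> extend_vec (h + w) (h \<bullet> w + 1) (h \<bullet> w) = 0"
      "extend_vec (h + w) (h \<bullet> w + 1) (h \<bullet> w) \<bullet> extend_vec g (g \<bullet> w) (g \<bullet> w) = 0"
      "extend_vec (g + w) (g \<bullet> w + 1) (g \<bullet> w) \<bullet> extend_vec (h + w) (h \<bullet> w + 1) (h \<bullet> w) = 0"
      if "g \<in> A" "h \<in> A" for g h
    proof -
      have g: "g \<in> carrier_vec n" and h: "h \<in> carrier_vec n" using that sub by auto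
      have gh: "g \<bullet> h = 0" "h \<bullet> g = 0" using that self_dual_orth[OF A] by auto
      have wg: "w \<bullet> h = h \<bullet> w" "w \<bullet> g = g \<bullet> w" using g h w comm_scalar_prod by auto
      note simps = extend_vec_scalar_prod[of _ n] scalar_prod_add_distrib[of _ n]
        add_scalar_prod_distrib[of _ n] g h w gh wg
      show "extend_vec g (g \<bullet> w) (g \<bullet> w) \<bullet> extend_vec h (h \<bullet> w) (h \<bullet> w) = 0"
        "extend_vec g (g \<bullet> w) (g \<bullet> w) \<bullet> extend_vec (h + w) (h \<bullet> w + 1) (h \<bullet> w) = 0"
        "extend_vec (h + w) (h \<bullet> w + 1) (h \<bullet> w) \<bullet> extend_vec g (g \<bullet> w) (g \<bullet> w) = 0"
        "extend_vec (g + w) (g \<bullet> w + 1) (g \<bullet> w) \<bullet> extend_vec (h + w) (h \<bullet> w + 1) (h \<bullet> w) = 0"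
        by (cases "g \<bullet> w"; cases "h \<bullet> w"; simp add: simps)+
    qed
    show ?thesis using that * unfolding child_of_def by blast
  qed
  have glue: "extend_vec w 1 0 \<in> child_of A w" using glue_mem_child_of[OF A w(1)] .
  have car: "child_of A w \<subseteq> carrier_vec (n + 2)" using child_of_carrier[OF sub w(1)] .
  \<comment> \<open>An appended pair \<open>s s\<close> contributes nothing against a word with
    equal last entries, so \<open>x\<close> is orthogonal to \<open>A\<close> and lies in it; the
    product with the glue vector then forces \<open>s = x \<bullet> w\<close>.\<close>
  have eq_case: "extend_vec x s s \<in> child_of A w"
    if x: "x \<in> carrier_vec n" and orth: "\<forall>u\<in>child_of A w. u \<bullet> extend_vec x s s = 0" for x s
  proof -
    have "g \<bullet> x = 0" if g: "g \<in> A" for g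
    proof -
      have "extend_vec g (g \<bullet> w) (g \<bullet> w) \<in> child_of A w" using g unfolding child_of_def by blast
      then have "extend_vec g (g \<bullet> w) (g \<bullet> w) \<bullet> extend_vec x s s = 0" using orth by blast
      then show ?thesis using g sub x
        by (subst (asm) extend_vec_scalar_prod[of _ n]) (auto simp: add.assoc bit_add_eq_0_iff)
    qed
    then have "x \<in> A" using self_dual_mem[OF A, of x] x by blast
    moreover have "w \<bullet> x + s = 0"
      using orth glue extend_vec_scalar_prod[OF w(1) x, of 1 0 s s] by auto
    ultimately show ?thesis
      using x w sub comm_scalar_prod[OF w(1) x] by (simp add: extend_mem_child_of bit_add_eq_0_iff)
  qed
  show ?thesis
  proof (intro equalityI subsetI)
    fix z assume "z \<in> child_of A w"
    then show "z \<in> dual_code (n + 2) (child_of A w)" using orth car unfolding mem_dual_code by blast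
  next
    fix z assume z: "z \<in> dual_code (n + 2) (child_of A w)"
    then obtain x s t where x: "x \<in> carrier_vec n" and zx: "z = extend_vec x s t"
      unfolding mem_dual_code using extend_vec_cases by metis
    have zo: "u \<bullet> extend_vec x s t = 0" if "u \<in> child_of A w" for u
      using z that unfolding mem_dual_code zx by blast
    show "z \<in> child_of A w"
    proof (cases "s = t")
      case True
      then show ?thesis using eq_case[OF x] zo zx by blast
    next
      case False
      then have st: "s + 1 = t" "t + 0 = t" by (cases s; cases t; simp)+
      have xw: "x + w \<in> carrier_vec n" using x w by simp
      \<comment> \<open>Adding the glue vector makes the last two entries equal and preserves
        orthogonality, because the glue vector itself is orthogonal to the child.\<close>
      have add: "extend_vec x s t + extend_vec w 1 0 = extend_vec (x + w) t t"
        unfolding extend_vec_add[OF x w(1)] st ..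
      have "u \<bullet> extend_vec (x + w) t t = 0" if "u \<in> child_of A w" for u
      proof -
        have "u \<in> carrier_vec (n + 2)" using that car by blast
        then show ?thesis unfolding add[symmetric]
          using zo[OF that] orth[OF that glue] x w by (simp add: scalar_prod_add_distrib[of _ "n + 2"])
      qed
      then have "extend_vec (x + w) t t \<in> child_of A w" using eq_case[OF xw] by blast
      then show ?thesis using False x w sub xw by (simp add: zx extend_mem_child_of)
    qed
  qed
qed

text \<open>Orthogonality to the glue vector forces \<open>s = x \<bullet> w\<close> for every word
  \<open>(x, s, s)\<close> of \<open>B\<close>, and adding the glue vector exchanges the words with
  equal and with distinct last entries. So the parent and one glue vector determine
  \<open>B\<close>.\<close>

lemma child_of_shortened:
  assumes B: "dual_code (n + 2) B = B" and w: "w \<in> carrier_vec n" and glue: "extend_vec w 1 0 \<in> B"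
  shows "dual_code n (shortened n B) = shortened n B" "w \<bullet> w = 1" "B = child_of (shortened n B) w"
proof -
  let ?A = "shortened n B"
  have sub: "?A \<subseteq> carrier_vec n" unfolding shortened_def by blast
  have "extend_vec w 1 0 \<bullet> extend_vec w 1 0 = 0" using self_dual_orth[OF B glue glue] .
  then show ww: "w \<bullet> w = 1"
    using extend_vec_scalar_prod[OF w w, of 1 0 1 0] by (simp add: bit_add_eq_0_iff)
  have s_eq: "s = x \<bullet> w" if "extend_vec x s s \<in> B" "x \<in> carrier_vec n" for x s
    using self_dual_orth[OF B that(1) glue] extend_vec_scalar_prod[OF that(2) w, of s s 1 0]
    by (simp add: bit_add_eq_0_iff)
  have mem_A: "x \<in> ?A \<longleftrightarrow> x \<in> carrier_vec n \<and> extend_vec x (x \<bullet> w) (x \<bullet> w) \<in> B" for x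
    unfolding shortened_def using s_eq by blast
  have ne_iff: "extend_vec x s t \<in> B \<longleftrightarrow> extend_vec (x + w) t t \<in> B"
    if x: "x \<in> carrier_vec n" and st: "s \<noteq> t" for x s t
  proof -
    have st': "s + 1 = t" "t + 1 = s" "t + 0 = t" using st by (cases s; cases t; simp)+
    have "extend_vec x s t + extend_vec w 1 0 = extend_vec (x + w) t t"
      unfolding extend_vec_add[OF x w] st' ..
    moreover have "extend_vec (x + w) t t + extend_vec w 1 0 = extend_vec x s t"
      unfolding extend_vec_add[OF add_carrier_vec[OF x w] w] bit_vec_add_cancel_right[OF x w] st' ..
    ultimately show ?thesis using self_dual_add[OF B _ glue] by metis
  qed
  have "?A \<subseteq> dual_code n ?A"
  proof
    fix y assume y: "y \<in> ?A"
    have "x \<bullet> y = 0" if x: "x \<in> ?A" for x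
    proof -
      obtain s t where "extend_vec x s s \<in> B" "extend_vec y t t \<in> B"
        using x y unfolding shortened_def by blast
      then have "extend_vec x s s \<bullet> extend_vec y t t = 0" using self_dual_orth[OF B] by blast
      then show ?thesis using x y sub
        by (subst (asm) extend_vec_scalar_prod[of _ n]) (auto simp: add.assoc bit_add_eq_0_iff)
    qed
    then show "y \<in> dual_code n ?A" using y sub unfolding mem_dual_code by blast
  qed
  moreover have "dual_code n ?A \<subseteq> ?A"
  proof
    fix z assume z: "z \<in> dual_code n ?A"
    then have zc: "z \<in> carrier_vec n" and zo: "\<And>x. x \<in> ?A \<Longrightarrow> x \<bullet> z = 0"
      unfolding mem_dual_code by blast+
    \<comment> \<open>The only possible lift of \<open>z\<close> with equal last entries appends
      \<open>z \<bullet> w\<close> twice. Once it is orthogonal to all of \<open>B\<close>,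
      self-duality of \<open>B\<close> puts it into \<open>B\<close>.\<close>
    have "u \<bullet> extend_vec z (z \<bullet> w) (z \<bullet> w) = 0" if u: "u \<in> B" for u
    proof -
      obtain x s t where x: "x \<in> carrier_vec n" and ux: "u = extend_vec x s t"
        using extend_vec_cases[OF self_dual_carrier[OF B u]] .
      show ?thesis
      proof (cases "s = t")
        case True
        then have "x \<in> ?A" using u x unfolding ux shortened_def by blast
        then have "x \<bullet> z = 0" by (rule zo)
        then show ?thesis
          using True x zc by (simp add: ux extend_vec_scalar_prod[of _ n] bit_add_eq_0_iff)
      next
        case False
        then have "x + w \<in> ?A"
          using u x w ne_iff[OF x False] unfolding ux shortened_def by auto
        then have "x \<bullet> z + w \<bullet> z = 0"
          using zo[of "x + w"] add_scalar_prod_distrib[OF x w zc] by simp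
        then have "x \<bullet> z = z \<bullet> w"
          using comm_scalar_prod[OF w zc] by (simp add: bit_add_eq_0_iff)
        moreover have "s * a + t * a = a" for a
          using False by (cases s; cases t; simp)
        ultimately show ?thesis using x zc
          by (simp add: ux extend_vec_scalar_prod[of _ n] add.assoc bit_add_eq_0_iff)
      qed
    qed
    then have "extend_vec z (z \<bullet> w) (z \<bullet> w) \<in> B"
      using self_dual_mem[OF B, of "extend_vec z (z \<bullet> w) (z \<bullet> w)"] zc by simp
    then show "z \<in> ?A" using zc mem_A by blast
  qed
  ultimately show "dual_code n ?A = ?A" by blast
  have "extend_vec x s t \<in> B \<longleftrightarrow> extend_vec x s t \<in> child_of ?A w" if x: "x \<in> carrier_vec n" for x s t
  proof (cases "s = t")
    case True
    then show ?thesis using x s_eq mem_A by (auto simp: extend_mem_child_of[OF sub w x])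
  next
    case False
    have "x + w \<in> carrier_vec n" using x w by simp
    then show ?thesis using ne_iff[OF x False] False s_eq mem_A
      by (auto simp: extend_mem_child_of[OF sub w x])
  qed
  then show "B = child_of ?A w"
    using self_dual_carrier[OF B] child_of_carrier[OF sub w]
    by (intro equalityI subsetI) (metis extend_vec_cases subsetD)+
qed

subsection \<open>Equivalences that preserve the pair of appended coordinates\<close>

text \<open>\<open>\<pi>\<close> preserves the appended pair as a set and \<open>\<sigma>\<close> is
  its action on the first \<open>n\<close> coordinates. The pair may be swapped because the
  functional determines a child only up to this swap.\<close>

definition lifts_perm :: "nat \<Rightarrow> (nat \<Rightarrow> nat) \<Rightarrow> (nat \<Rightarrow> nat) \<Rightarrow> bool" where
  "lifts_perm n \<sigma> \<pi> \<longleftrightarrow>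
     \<sigma> permutes {..<n} \<and> (\<pi> = \<sigma> \<or> \<pi> = Transposition.transpose n (Suc n) \<circ> \<sigma>)"

lemma swap_last_permutes: "Transposition.transpose n (Suc n) permutes {..<n + 2}"
  by (intro permutes_swap_id) auto

lemma
  assumes "lifts_perm n \<sigma> \<pi>"
  shows lifts_perm_permutes: "\<pi> permutes {..<n + 2}"
    and lifts_perm_pair: "{\<pi> n, \<pi> (Suc n)} = {n, Suc n}"
proof -
  have \<sigma>: "\<sigma> permutes {..<n}" using assms unfolding lifts_perm_def by blast
  then have "\<sigma> permutes {..<n + 2}" by (rule permutes_subset) auto
  then show "\<pi> permutes {..<n + 2}"
    using assms swap_last_permutes permutes_compose unfolding lifts_perm_def by blast
  have "\<sigma> n = n" "\<sigma> (Suc n) = Suc n" using permutes_not_in[OF \<sigma>] by auto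
  then show "{\<pi> n, \<pi> (Suc n)} = {n, Suc n}" using assms unfolding lifts_perm_def by auto
qed

text \<open>On the pair, \<open>\<pi>\<close> is the identity or the swap. Composing with the swap
  reduces the second case to the first, where a permutation of \<open>{..<n}\<close>
  remains.\<close>

lemma lifts_perm_exists:
  assumes \<pi>: "\<pi> permutes {..<n + 2}" and pair: "{\<pi> n, \<pi> (Suc n)} = {n, Suc n}"
  shows "\<exists>\<sigma>. lifts_perm n \<sigma> \<pi>"
proof -
  let ?t = "Transposition.transpose n (Suc n)"
  have less: "\<rho> permutes {..<n}"
    if "\<rho> permutes {..<n + 2}" "\<rho> n = n" "\<rho> (Suc n) = Suc n" for \<rho>
    using that by (intro permutes_superset[OF that(1)]) (auto simp: less_Suc_eq)
  have "(\<pi> n = n \<and> \<pi> (Suc n) = Suc n) \<or> (\<pi> n = Suc n \<and> \<pi> (Suc n) = n)"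
    using pair by (auto simp: doubleton_eq_iff)
  then show ?thesis
  proof
    assume "\<pi> n = n \<and> \<pi> (Suc n) = Suc n"
    then show ?thesis using less[OF \<pi>] unfolding lifts_perm_def by blast
  next
    assume "\<pi> n = Suc n \<and> \<pi> (Suc n) = n"
    then have "?t \<circ> \<pi> permutes {..<n}"
      using less[OF permutes_compose[OF \<pi> swap_last_permutes]] by simp
    moreover have "\<pi> = ?t \<circ> (?t \<circ> \<pi>)" by (simp add: comp_assoc[symmetric])
    ultimately show ?thesis unfolding lifts_perm_def by blast
  qed
qed

lemma permute_extend_vec_lift:
  assumes "lifts_perm n \<sigma> \<pi>" "x \<in> carrier_vec n"
  shows "permute_vec \<pi> (extend_vec x s t) \<in>
    {extend_vec (permute_vec \<sigma> x) s t, extend_vec (permute_vec \<sigma> x) t s}"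
proof -
  have \<sigma>: "\<sigma> permutes {..<n}" using assms unfolding lifts_perm_def by blast
  have \<sigma>': "\<sigma> permutes {..<n + 2}" using permutes_subset[OF \<sigma>, of "{..<n + 2}"] by auto
  have "permute_vec (Transposition.transpose n (Suc n) \<circ> \<sigma>) (extend_vec x s t)
      = extend_vec (permute_vec \<sigma> x) t s"
    using assms(2)
    by (simp add: permute_vec_comp[OF swap_last_permutes \<sigma>'] permute_extend_vec[OF \<sigma>] swap_extend_vec)
  then show ?thesis
    using assms permute_extend_vec[OF \<sigma> assms(2)] unfolding lifts_perm_def by auto
qed

text \<open>The parent only sees words whose last two entries are equal, and on these the swap is
  invisible.\<close>

lemma shortened_permute_code:
  assumes l: "lifts_perm n \<sigma> \<pi>" and B: "B \<subseteq> carrier_vec (n + 2)"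
  shows "shortened n (permute_code \<pi> B) = permute_code \<sigma> (shortened n B)"
proof -
  have \<sigma>: "\<sigma> permutes {..<n}" using l unfolding lifts_perm_def by blast
  have ext: "permute_vec \<pi> (extend_vec x s s) = extend_vec (permute_vec \<sigma> x) s s"
    if "x \<in> carrier_vec n" for x s
    using permute_extend_vec_lift[OF l that, of s s] by simp
  show ?thesis
  proof (intro equalityI subsetI)
    fix y assume "y \<in> shortened n (permute_code \<pi> B)"
    then obtain s where y: "y \<in> carrier_vec n" and "extend_vec y s s \<in> permute_code \<pi> B"
      unfolding shortened_def by blast
    then obtain u where u: "u \<in> B" "extend_vec y s s = permute_vec \<pi> u"
      unfolding permute_code_def by blast
    let ?x = "permute_vec (Hilbert_Choice.inv \<sigma>) y"
    have "permute_vec \<pi> (extend_vec ?x s s) = permute_vec \<pi> u"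
      using ext[of ?x s] permute_vec_inv(2)[OF \<sigma> y] y u by simp
    then have "extend_vec ?x s s = u"
      using permute_vec_inj_on[OF lifts_perm_permutes[OF l]] u(1) B y
      by (auto dest!: inj_onD simp: subset_iff)
    then have "?x \<in> shortened n B" using u y unfolding shortened_def by auto
    then show "y \<in> permute_code \<sigma> (shortened n B)"
      unfolding permute_code_def using permute_vec_inv(2)[OF \<sigma> y] by (metis image_eqI)
  next
    fix y assume "y \<in> permute_code \<sigma> (shortened n B)"
    then obtain x s where "x \<in> carrier_vec n" "extend_vec x s s \<in> B" "y = permute_vec \<sigma> x"
      unfolding shortened_def permute_code_def by blast
    then show "y \<in> shortened n (permute_code \<pi> B)"
      unfolding shortened_def permute_code_def using ext[of x s]
      by (metis (mono_tags, lifting) image_eqI mem_Collect_eq permute_vec_carrier)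
  qed
qed

text \<open>A word on which the last two coordinates differ serves as glue vector. This is where the
  assumption on canonical forms enters.\<close>

lemma self_dual_imp_child_of:
  assumes B: "dual_code (n + 2) B = B" and ne: "\<not> equal_coords B n (Suc n)"
  shows "\<exists>w \<pi>. w \<in> carrier_vec n \<and> w \<bullet> w = 1 \<and> dual_code n (shortened n B) = shortened n B \<and>
    lifts_perm n id \<pi> \<and> permute_code \<pi> B = child_of (shortened n B) w"
proof -
  obtain z where z: "z \<in> B" "z $ n \<noteq> z $ Suc n" using ne unfolding equal_coords_def by blast
  then obtain w s t where w: "w \<in> carrier_vec n" and zw: "z = extend_vec w s t"
    using extend_vec_cases self_dual_carrier[OF B] by metis
  have st: "s \<noteq> t" using z index_extend_vec(2,3)[OF w] unfolding zw by metis
  \<comment> \<open>The pair of \<open>z\<close> reads 1 0 or 0 1; in the second case the swap turns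
    \<open>z\<close> into a glue vector.\<close>
  have "\<exists>\<pi>. lifts_perm n id \<pi> \<and> permute_vec \<pi> (extend_vec w s t) = extend_vec w 1 0"
  proof (cases s)
    case zero
    then have "t = 1" using st by (cases t) simp_all
    then show ?thesis using swap_extend_vec[OF w, of s t] zero
      unfolding lifts_perm_def by (auto simp: permutes_id)
  next
    case one
    then have "t = 0" using st by (cases t) simp_all
    then show ?thesis using one
      by (intro exI[of _ id]) (simp add: lifts_perm_def permutes_id)
  qed
  then obtain \<pi> where l: "lifts_perm n id \<pi>"
    and "permute_vec \<pi> (extend_vec w s t) = extend_vec w 1 0" by blast
  then have "extend_vec w 1 0 \<in> permute_code \<pi> B"
    using z unfolding zw permute_code_def by (metis image_eqI)
  moreover have "shortened n (permute_code \<pi> B) = shortened n B"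
    using shortened_permute_code[OF l] self_dual_carrier[OF B] by auto
  moreover have "dual_code (n + 2) (permute_code \<pi> B) = permute_code \<pi> B"
    using permute_code_self_dual[OF lifts_perm_permutes[OF l] B] .
  ultimately show ?thesis using child_of_shortened[of n "permute_code \<pi> B" w] w l by auto
qed

text \<open>Up to the swap, a child depends only on its parent and on the functional given by
  \<open>w\<close>, not on \<open>w\<close> itself. The image under \<open>\<sigma>\<close> is
  self-dual with parent \<open>A'\<close>, so it is enough to find \<open>(w', 1, 0)\<close> in it,
  possibly after a swap.\<close>

lemma child_of_equiv:
  assumes A: "dual_code n A = A" and A': "dual_code n A' = A'"
    and w: "w \<in> carrier_vec n" "w \<bullet> w = 1" and w': "w' \<in> carrier_vec n"
    and \<sigma>: "\<sigma> permutes {..<n}" and \<sigma>A: "permute_code \<sigma> A = A'"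
    and eq: "\<And>g. g \<in> A \<Longrightarrow> g \<bullet> w = permute_vec \<sigma> g \<bullet> w'"
  shows "\<exists>\<tau> \<pi>. lifts_perm n \<tau> \<pi> \<and> permute_code \<pi> (child_of A w) = child_of A' w'"
proof -
  have sub: "A \<subseteq> carrier_vec n" "A' \<subseteq> carrier_vec n"
    using self_dual_carrier[OF A] self_dual_carrier[OF A'] by auto
  let ?B = "permute_code \<sigma> (child_of A w)" and ?h = "permute_vec \<sigma> w + w'"
  have l: "lifts_perm n \<sigma> \<sigma>" using \<sigma> unfolding lifts_perm_def by blast
  have Bcar: "child_of A w \<subseteq> carrier_vec (n + 2)" using child_of_carrier[OF sub(1) w(1)] .
  have B: "dual_code (n + 2) ?B = ?B"
    using permute_code_self_dual[OF lifts_perm_permutes[OF l] child_of_self_dual[OF A w]] .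
  have short: "shortened n ?B = A'"
    using shortened_permute_code[OF l Bcar] shortened_child_of[OF sub(1) w(1)] \<sigma>A by simp
  have glue: "extend_vec (permute_vec \<sigma> w) 1 0 \<in> ?B"
    using glue_mem_child_of[OF A w(1)] permute_extend_vec[OF \<sigma> w(1)]
    unfolding permute_code_def by (metis image_eqI)
  \<comment> \<open>The hypothesis on the functionals says that
    \<open>permute_vec \<sigma> w\<close> and \<open>w'\<close> agree on \<open>A'\<close>. Their
    sum is then orthogonal to \<open>A'\<close>, hence lies in \<open>A'\<close> and lifts to a word
    \<open>(?h, s, s)\<close> of the image.\<close>
  have "g' \<bullet> ?h = 0" if g': "g' \<in> A'" for g'
  proof -
    obtain g where g: "g \<in> A" "g' = permute_vec \<sigma> g" using g' \<sigma>A unfolding permute_code_def by blast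
    then have gc: "g \<in> carrier_vec n" using sub by blast
    then show ?thesis
      using w w' eq[OF g(1)] unfolding g(2)
      by (simp add: scalar_prod_add_distrib[of _ n] permute_vec_scalar_prod[OF \<sigma>] bit_add_eq_0_iff)
  qed
  then have "?h \<in> A'" using self_dual_mem[OF A', of ?h] w w' by simp
  then obtain s where s: "extend_vec ?h s s \<in> ?B" unfolding short[symmetric] shortened_def by blast
  have "permute_vec \<sigma> w + ?h = w'"
    using w w' by (intro eq_vecI) (simp_all add: add.assoc[symmetric] bit_add_eq_0_iff)
  then have glue': "extend_vec w' (1 + s) s \<in> ?B"
    using self_dual_add[OF B glue s] w w' extend_vec_add[of "permute_vec \<sigma> w" n ?h 1 0 s s] by simp
  \<comment> \<open>The word found is \<open>(w', 1 + s, s)\<close>: a glue vector for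
    \<open>s = 0\<close>, and the swap of one for \<open>s = 1\<close>.\<close>
  have "\<exists>\<pi>. lifts_perm n \<sigma> \<pi> \<and> extend_vec w' 1 0 \<in> permute_code \<pi> (child_of A w)"
  proof (cases s)
    case zero
    then show ?thesis using l glue' by auto
  next
    case one
    have "permute_code (Transposition.transpose n (Suc n) \<circ> \<sigma>) (child_of A w)
        = permute_code (Transposition.transpose n (Suc n)) ?B"
      using permute_code_comp[OF swap_last_permutes lifts_perm_permutes[OF l] Bcar] .
    moreover have "extend_vec w' 1 0 \<in> permute_code (Transposition.transpose n (Suc n)) ?B"
      using imageI[OF glue', of "permute_vec (Transposition.transpose n (Suc n))"]
        swap_extend_vec[OF w', of "1 + s" s] one
      unfolding permute_code_def[of "Transposition.transpose n (Suc n)"] by simp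
    ultimately show ?thesis using \<sigma> one unfolding lifts_perm_def by auto
  qed
  then obtain \<pi> where l': "lifts_perm n \<sigma> \<pi>"
    and g: "extend_vec w' 1 0 \<in> permute_code \<pi> (child_of A w)" by blast
  have "shortened n (permute_code \<pi> (child_of A w)) = A'"
    using shortened_permute_code[OF l' Bcar] shortened_child_of[OF sub(1) w(1)] \<sigma>A by simp
  moreover have "dual_code (n + 2) (permute_code \<pi> (child_of A w)) = permute_code \<pi> (child_of A w)"
    using permute_code_self_dual[OF lifts_perm_permutes[OF l'] child_of_self_dual[OF A w]] .
  ultimately show ?thesis using child_of_shortened(3)[OF _ w' g] l' by metis
qed

text \<open>Converse of the preceding correspondence: taking parents on both sides gives the first
  claim, and following the word \<open>(g, g \<bullet> w, g \<bullet> w)\<close> reads off the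
  functional, since the swap does not move it.\<close>

lemma child_of_equiv_imp:
  assumes A: "dual_code n A = A" and A': "dual_code n A' = A'"
    and w: "w \<in> carrier_vec n" and w': "w' \<in> carrier_vec n"
    and l: "lifts_perm n \<sigma> \<pi>" and eq: "permute_code \<pi> (child_of A w) = child_of A' w'"
  shows "permute_code \<sigma> A = A'" "\<And>g. g \<in> A \<Longrightarrow> g \<bullet> w = permute_vec \<sigma> g \<bullet> w'"
proof -
  have sub: "A \<subseteq> carrier_vec n" "A' \<subseteq> carrier_vec n"
    using self_dual_carrier[OF A] self_dual_carrier[OF A'] by auto
  show "permute_code \<sigma> A = A'"
    using shortened_permute_code[OF l child_of_carrier[OF sub(1) w]]
    unfolding eq shortened_child_of[OF sub(1) w] shortened_child_of[OF sub(2) w'] by simp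
  fix g assume g: "g \<in> A"
  then have gc: "g \<in> carrier_vec n" using sub by blast
  have "extend_vec g (g \<bullet> w) (g \<bullet> w) \<in> child_of A w" using g unfolding child_of_def by blast
  then have "permute_vec \<pi> (extend_vec g (g \<bullet> w) (g \<bullet> w)) \<in> child_of A' w'"
    unfolding eq[symmetric] permute_code_def by blast
  then have "extend_vec (permute_vec \<sigma> g) (g \<bullet> w) (g \<bullet> w) \<in> child_of A' w'"
    using permute_extend_vec_lift[OF l gc, of "g \<bullet> w" "g \<bullet> w"] by simp
  then show "g \<bullet> w = permute_vec \<sigma> g \<bullet> w'"
    using extend_mem_child_of[OF sub(2) w', of "permute_vec \<sigma> g"] gc by simp
qed

subsection \<open>Systematic generator matrices\<close>

text \<open>The glue vector of the child type code without its appended pair. On \<open>A\<close> it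
  represents the functional whose coordinate vector with respect to the rows of \<open>G\<close> is
  \<open>a\<close>.\<close>

definition info_vec :: "nat \<Rightarrow> (nat \<Rightarrow> nat) \<Rightarrow> bit vec \<Rightarrow> bit vec" where
  "info_vec m p a = vec (2 * m)
     (\<lambda>j. if j \<in> p ` {..<m} then a $ the_inv_into {..<m} p j else 0)"

lemma info_vec_carrier [simp]: "info_vec m p a \<in> carrier_vec (2 * m)"
  by (simp add: info_vec_def)

lemma glue_vec_eq: "glue_vec m p a = extend_vec (info_vec m p a) 1 0"
  by (intro eq_vecI) (auto simp: glue_vec_def info_vec_def extend_vec_def less_Suc_eq)

lemma of_nat_bit: "(of_nat n :: bit) = of_bool (odd n)"
  by (induct n) simp_all

section \<open>Permutation matrices, and equality tests for matrices and vectors\<close>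

lemma perm_mat_carrier [simp]: "perm_mat n \<sigma> \<in> carrier_mat n n"
  by (simp add: perm_mat_def)

lemma transpose_perm_mat_mult_vec:
  assumes \<sigma>: "\<sigma> permutes {..<n}" and x: "x \<in> carrier_vec n"
  shows "(perm_mat n \<sigma>)\<^sup>T *\<^sub>v x = permute_vec \<sigma> x"
proof (intro eq_vecI)
  fix j assume "j < dim_vec (permute_vec \<sigma> x)"
  then have j: "j < n" using x by simp
  have "((perm_mat n \<sigma>)\<^sup>T *\<^sub>v x) $ j = (\<Sum>i = 0..<n. (if j = \<sigma> i then 1 else 0) * x $ i)"
    using j x by (simp add: perm_mat_def scalar_prod_def)
  also have "\<dots> = (\<Sum>i = 0..<n. if i = Hilbert_Choice.inv \<sigma> j then x $ i else 0)"
    using permutes_inverses[OF \<sigma>] by (intro sum.cong) auto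
  also have "\<dots> = permute_vec \<sigma> x $ j"
    using j x permutes_inv_less[OF \<sigma> j] by (simp add: index_permute_vec)
  finally show "((perm_mat n \<sigma>)\<^sup>T *\<^sub>v x) $ j = permute_vec \<sigma> x $ j" .
qed (use x in \<open>simp add: perm_mat_def\<close>)

lemma perm_mat_mult_inv:
  assumes \<sigma>: "\<sigma> permutes {..<n}" and \<tau>: "\<tau> permutes {..<n}" and inv: "\<And>i. \<tau> (\<sigma> i) = i"
  shows "perm_mat n \<sigma> * perm_mat n \<tau> = 1\<^sub>m n"
proof (intro eq_matI)
  fix i j assume "i < dim_row (1\<^sub>m n :: bit mat)" "j < dim_col (1\<^sub>m n :: bit mat)"
  then have ij: "i < n" "j < n" by simp_all
  have "(perm_mat n \<sigma> * perm_mat n \<tau>) $$ (i, j)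
      = (\<Sum>k = 0..<n. (if k = \<sigma> i then 1 else 0) * (if j = \<tau> k then 1 else 0))"
    using ij by (simp add: perm_mat_def scalar_prod_def)
  also have "\<dots> = (\<Sum>k = 0..<n. if k = \<sigma> i then (if j = \<tau> (\<sigma> i) then 1 else 0) else 0)"
    by (intro sum.cong) auto
  also have "\<dots> = (1\<^sub>m n :: bit mat) $$ (i, j)"
    using ij permutes_in_image[OF \<sigma>, of i] inv by auto
  finally show "(perm_mat n \<sigma> * perm_mat n \<tau>) $$ (i, j) = (1\<^sub>m n :: bit mat) $$ (i, j)" .
qed (simp_all add: perm_mat_def)

lemma eq_mat_if_eq_mult_vec:
  fixes X Y :: "bit mat"
  assumes "X \<in> carrier_mat nr nc" "Y \<in> carrier_mat nr nc"
    and "\<And>v. v \<in> carrier_vec nc \<Longrightarrow> X *\<^sub>v v = Y *\<^sub>v v"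
  shows "X = Y"
proof (rule eq_matI)
  fix i j assume ij: "i < dim_row Y" "j < dim_col Y"
  have "X *\<^sub>v unit_vec nc j = Y *\<^sub>v unit_vec nc j" using assms(3) by simp
  then have "(X *\<^sub>v unit_vec nc j) $ i = (Y *\<^sub>v unit_vec nc j) $ i" by simp
  then show "X $$ (i, j) = Y $$ (i, j)" using ij assms(1,2) by simp
qed (use assms in simp_all)

lemma eq_vec_if_eq_scalar_prod:
  fixes x y :: "bit vec"
  assumes "x \<in> carrier_vec n" "y \<in> carrier_vec n"
    and "\<And>c. c \<in> carrier_vec n \<Longrightarrow> c \<bullet> x = c \<bullet> y"
  shows "x = y"
proof (rule eq_vecI)
  fix i assume i: "i < dim_vec y"
  have "unit_vec n i \<bullet> x = unit_vec n i \<bullet> y" using assms(3) by simp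
  then show "x $ i = y $ i" using i assms(1,2) by simp
qed (use assms in simp)

section \<open>Functionals on a self-dual code in coordinates of a systematic generator
  matrix\<close>

locale systematic =
  fixes m :: nat and A :: code and G :: "bit mat" and p :: "nat \<Rightarrow> nat"
  assumes gen: "systematic_generator m A G p" and A: "dual_code (2 * m) A = A"
begin

lemma G [simp]: "G \<in> carrier_mat m (2 * m)"
  and p_less: "i < m \<Longrightarrow> p i < 2 * m"
  and col_G_p: "i < m \<Longrightarrow> col G (p i) = unit_vec m i"
  using gen unfolding systematic_generator_def by blast+

lemma A_carrier: "A \<subseteq> carrier_vec (2 * m)"
  using self_dual_carrier[OF A] by blast

lemma A_eq: "A = (\<lambda>c. G\<^sup>T *\<^sub>v c) ` carrier_vec m"
proof -
  interpret vec_space "TYPE(bit)" "2 * m" .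
  have "A = row_space G" using gen unfolding systematic_generator_def by blast
  also have "\<dots> = {w \<in> carrier_vec (dim_col G). \<exists>y\<in>carrier_vec (dim_row G). G\<^sup>T *\<^sub>v y = w}"
    using row_space_eq[OF G] .
  also have "\<dots> = (\<lambda>c. G\<^sup>T *\<^sub>v c) ` carrier_vec m"
    using carrier_matD[OF G] by (auto intro!: mult_mat_vec_carrier)
  finally show ?thesis .
qed

lemma inj_p: "inj_on p {..<m}"
proof (rule inj_onI)
  fix i j assume ij: "i \<in> {..<m}" "j \<in> {..<m}" "p i = p j"
  then have "unit_vec m i = (unit_vec m j :: bit vec)" using col_G_p by (metis lessThan_iff)
  then have "unit_vec m i $ i = (unit_vec m j :: bit vec) $ i" by simp
  then show "i = j" using ij by (simp split: if_splits)
qed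

lemma scalar_prod_info_vec:
  assumes "x \<in> carrier_vec (2 * m)"
  shows "x \<bullet> info_vec m p a = (\<Sum>i<m. x $ p i * a $ i)"
proof -
  have sub: "p ` {..<m} \<subseteq> {..<2 * m}" using p_less by auto
  have "x \<bullet> info_vec m p a
      = (\<Sum>j<2 * m. if j \<in> p ` {..<m} then x $ j * a $ the_inv_into {..<m} p j else 0)"
    by (simp add: scalar_prod_def info_vec_def atLeast0LessThan if_distrib cong: if_cong)
  also have "\<dots> = (\<Sum>j\<in>p ` {..<m}. x $ j * a $ the_inv_into {..<m} p j)"
    using sub by (simp add: sum.inter_restrict[symmetric] Int_absorb1)
  also have "\<dots> = (\<Sum>i<m. x $ p i * a $ i)"
    using inj_p by (simp add: sum.reindex the_inv_into_f_f)
  finally show ?thesis .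
qed

lemma G_T_mult_p:
  assumes "c \<in> carrier_vec m" "i < m"
  shows "(G\<^sup>T *\<^sub>v c) $ p i = c $ i"
  using assms p_less[of i] col_G_p[of i] carrier_matD[OF G] by simp

text \<open>The codeword with message \<open>c\<close> carries \<open>c\<close> in its information
  positions, and \<open>info_vec\<close> is supported exactly there.\<close>

lemma G_T_scalar_prod_info:
  assumes c: "c \<in> carrier_vec m" and a: "a \<in> carrier_vec m"
  shows "(G\<^sup>T *\<^sub>v c) \<bullet> info_vec m p a = c \<bullet> a"
proof -
  have "G\<^sup>T *\<^sub>v c \<in> carrier_vec (2 * m)" using c A_eq A_carrier by blast
  then show ?thesis using c a
    by (simp add: scalar_prod_info_vec G_T_mult_p scalar_prod_def[of c] atLeast0LessThan)
qed

lemma info_vec_p: "i < m \<Longrightarrow> info_vec m p a $ p i = a $ i"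
  using p_less inj_p by (simp add: info_vec_def the_inv_into_f_f)

text \<open>Elements of \<open>bit\<close> are idempotent, so a self product is the parity of the
  weight. Odd weight is thus the condition \<open>w \<bullet> w = 1\<close> on glue vectors.\<close>

lemma info_vec_self:
  "info_vec m p a \<bullet> info_vec m p a = of_bool (odd (card {i. i < m \<and> a $ i = 1}))"
proof -
  have "info_vec m p a \<bullet> info_vec m p a = (\<Sum>i<m. a $ i * a $ i)"
    by (simp add: scalar_prod_info_vec info_vec_p)
  also have "\<dots> = (\<Sum>i<m. if a $ i = 1 then 1 else 0)"
  proof (intro sum.cong refl)
    show "a $ i * a $ i = (if a $ i = 1 then 1 else 0)" for i by (cases "a $ i") simp_all
  qed
  also have "\<dots> = of_nat (card {i \<in> {..<m}. a $ i = 1})"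
    by (simp add: sum.If_cases Int_def)
  finally show ?thesis by (simp add: of_nat_bit)
qed

lemma odd_weight_iff:
  "a \<in> odd_weight_vecs m \<longleftrightarrow> a \<in> carrier_vec m \<and> info_vec m p a \<bullet> info_vec m p a = 1"
  unfolding odd_weight_vecs_def info_vec_self by simp

text \<open>The vector \<open>G *\<^sub>v w\<close> lists the values of the functional on the rows
  of \<open>G\<close>, so every glue vector may be replaced by one supported on the information
  positions without changing the functional.\<close>

lemma info_vec_of_functional:
  assumes w: "w \<in> carrier_vec (2 * m)"
  shows "g \<in> A \<Longrightarrow> g \<bullet> info_vec m p (G *\<^sub>v w) = g \<bullet> w"
    and "w \<bullet> w = 1 \<Longrightarrow> G *\<^sub>v w \<in> odd_weight_vecs m"
proof -
  let ?i = "info_vec m p (G *\<^sub>v w)"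
  have Gw: "G *\<^sub>v w \<in> carrier_vec m" using mult_mat_vec_carrier[OF G w] .
  show eq: "g \<bullet> ?i = g \<bullet> w" if g: "g \<in> A" for g
  proof -
    obtain c where c: "c \<in> carrier_vec m" "g = G\<^sup>T *\<^sub>v c" using g A_eq by blast
    then have "g \<bullet> ?i = c \<bullet> (G *\<^sub>v w)" using G_T_scalar_prod_info Gw by simp
    also have "\<dots> = g \<bullet> w"
      unfolding c(2) by (rule transpose_vec_mult_scalar[OF G w c(1), symmetric])
    finally show ?thesis .
  qed
  show "G *\<^sub>v w \<in> odd_weight_vecs m" if "w \<bullet> w = 1"
  proof -
    \<comment> \<open>Both vectors give the same functional on \<open>A\<close>, so their sum is in
      the dual, which is \<open>A\<close>. Evaluating the functionals at this very sum compares the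
      self products.\<close>
    have "x \<bullet> (?i + w) = 0" if "x \<in> A" for x
      using eq[OF that] that A_carrier w
      by (subst scalar_prod_add_distrib[of _ "2 * m"]) (auto simp: bit_add_eq_0_iff)
    then have h: "?i + w \<in> A" using self_dual_mem[OF A, of "?i + w"] w by simp
    have "(?i + w) \<bullet> ?i = (?i + w) \<bullet> w" using eq[OF h] .
    then have "?i \<bullet> ?i + w \<bullet> ?i = ?i \<bullet> w + w \<bullet> w"
      using w by (simp add: add_scalar_prod_distrib[of _ "2 * m"])
    then have "?i \<bullet> ?i = w \<bullet> w"
      using comm_scalar_prod[OF w, of ?i] by (simp add: add.commute)
    then show ?thesis using that Gw odd_weight_iff by simp
  qed
qed

text \<open>Encoding a message \<open>c\<close> with the extended matrix appends
  \<open>c \<bullet> a\<close> twice, and this is the value of the functional at the codeword of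
  \<open>c\<close>.\<close>

lemma row_space_extended_generator:
  assumes a: "a \<in> carrier_vec m"
  shows "vec_space.row_space (2 * m + 2) (extended_generator m G a) =
    (\<lambda>g. extend_vec g (g \<bullet> info_vec m p a) (g \<bullet> info_vec m p a)) ` A"
proof -
  interpret vec_space "TYPE(bit)" "2 * m + 2" .
  let ?E = "extended_generator m G a"
  have E: "?E \<in> carrier_mat m (2 * m + 2)" by (simp add: extended_generator_def)
  have mult: "?E\<^sup>T *\<^sub>v c = extend_vec (G\<^sup>T *\<^sub>v c) (c \<bullet> a) (c \<bullet> a)" if c: "c \<in> carrier_vec m" for c
  proof (intro eq_vecI)
    fix j assume "j < dim_vec (extend_vec (G\<^sup>T *\<^sub>v c) (c \<bullet> a) (c \<bullet> a))"
    then have j: "j < 2 * m + 2" using carrier_matD[OF G] by simp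
    have "(?E\<^sup>T *\<^sub>v c) $ j = col ?E j \<bullet> c" using j E by simp
    also have "col ?E j = (if j < 2 * m then col G j else a)"
      using j a carrier_matD[OF G] by (intro eq_vecI) (auto simp: extended_generator_def)
    finally show "(?E\<^sup>T *\<^sub>v c) $ j = extend_vec (G\<^sup>T *\<^sub>v c) (c \<bullet> a) (c \<bullet> a) $ j"
      using j carrier_matD[OF G] comm_scalar_prod[OF a c] by (simp add: extend_vec_def)
  qed (use E carrier_matD[OF G] in simp)
  have "row_space ?E = {w \<in> carrier_vec (dim_col ?E). \<exists>y\<in>carrier_vec (dim_row ?E). ?E\<^sup>T *\<^sub>v y = w}"
    using row_space_eq[OF E] .
  also have "\<dots> = (\<lambda>c. ?E\<^sup>T *\<^sub>v c) ` carrier_vec m"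
    using carrier_matD[OF E] by (auto intro!: mult_mat_vec_carrier)
  also have "\<dots> = (\<lambda>c. extend_vec (G\<^sup>T *\<^sub>v c) (c \<bullet> a) (c \<bullet> a)) ` carrier_vec m"
    using mult by (intro image_cong) simp_all
  also have "\<dots> = (\<lambda>g. extend_vec g (g \<bullet> info_vec m p a) (g \<bullet> info_vec m p a)) ` A"
    unfolding A_eq image_image using G_T_scalar_prod_info[OF _ a] by (intro image_cong) simp_all
  finally show ?thesis .
qed

text \<open>\<open>child_of\<close> is a linear code containing the generators, and each of its
  words is a word of the row space or the sum of one with the glue vector.\<close>

lemma child_code_eq:
  assumes a: "a \<in> odd_weight_vecs m"
  shows "child_code m G p a = child_of A (info_vec m p a)"
proof -
  interpret vec_space "TYPE(bit)" "2 * m + 2" .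
  let ?w = "info_vec m p a"
  let ?V = "(\<lambda>g. extend_vec g (g \<bullet> ?w) (g \<bullet> ?w)) ` A"
  have w: "?w \<in> carrier_vec (2 * m)" "?w \<bullet> ?w = 1" and ac: "a \<in> carrier_vec m"
    using a odd_weight_iff by auto
  have "submodule class_ring (child_of A ?w) V"
    using self_dual_subspace[OF child_of_self_dual[OF A w]] unfolding subspace_def by blast
  moreover have "insert (extend_vec ?w 1 0) ?V \<subseteq> child_of A ?w"
    using glue_mem_child_of[OF A w(1)] unfolding child_of_def by blast
  ultimately have 1: "span (insert (extend_vec ?w 1 0) ?V) \<subseteq> child_of A ?w"
    using span_is_subset by blast
  have car: "insert (extend_vec ?w 1 0) ?V \<subseteq> carrier_vec (2 * m + 2)"
    using A_carrier w by auto
  have own: "insert (extend_vec ?w 1 0) ?V \<subseteq> span (insert (extend_vec ?w 1 0) ?V)"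
    using in_own_span[OF car] .
  have "child_of A ?w \<subseteq> span (insert (extend_vec ?w 1 0) ?V)"
  proof
    fix z assume "z \<in> child_of A ?w"
    then consider "z \<in> ?V"
      | g where "g \<in> A" "z = extend_vec (g + ?w) (g \<bullet> ?w + 1) (g \<bullet> ?w)"
      unfolding child_of_def by blast
    then show "z \<in> span (insert (extend_vec ?w 1 0) ?V)"
    proof cases
      case 1
      then show ?thesis using own by blast
    next
      case (2 g)
      have "z = extend_vec g (g \<bullet> ?w) (g \<bullet> ?w) + extend_vec ?w 1 0"
        using 2 A_carrier w by (subst extend_vec_add[of _ "2 * m"]) auto
      then show ?thesis using own 2(1) span_add1[OF car] by auto
    qed
  qed
  then show ?thesis
    using 1 unfolding child_code_def glue_vec_eq row_space_extended_generator[OF ac] by blast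
qed

text \<open>Column \<open>p j\<close> of \<open>Z * G\<close> is column \<open>j\<close> of
  \<open>Z\<close>, so \<open>G\<close> cancels on the right.\<close>

lemma mult_G_cancel:
  assumes X: "X \<in> carrier_mat m m" and Y: "Y \<in> carrier_mat m m" and eq: "X * G = Y * G"
  shows "X = Y"
proof (rule eq_matI)
  fix i j assume "i < dim_row Y" "j < dim_col Y"
  then have ij: "i < m" "j < m" using Y by auto
  have "(Z * G) $$ (i, p j) = Z $$ (i, j)" if "Z \<in> carrier_mat m m" for Z
    using that ij p_less[of j] col_G_p[of j] carrier_matD[OF G] by simp
  then show "X $$ (i, j) = Y $$ (i, j)" using X Y eq by metis
qed (use X Y in auto)

lemma perm_mat_action:
  assumes \<sigma>: "\<sigma> permutes {..<2 * m}" and c: "c \<in> carrier_vec m"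
  shows "(G * perm_mat (2 * m) \<sigma>)\<^sup>T *\<^sub>v c = permute_vec \<sigma> (G\<^sup>T *\<^sub>v c)"
proof -
  have Gt: "G\<^sup>T \<in> carrier_mat (2 * m) m" by simp
  have Pt: "(perm_mat (2 * m) \<sigma>)\<^sup>T \<in> carrier_mat (2 * m) (2 * m)" by simp
  have "(G * perm_mat (2 * m) \<sigma>)\<^sup>T = (perm_mat (2 * m) \<sigma>)\<^sup>T * G\<^sup>T"
    using transpose_mult[OF G perm_mat_carrier] .
  then show ?thesis
    using assoc_mult_mat_vec[OF Pt Gt c] mult_mat_vec_carrier[OF Gt c]
      transpose_perm_mat_mult_vec[OF \<sigma>] by simp
qed

lemma automorphism_matrix:
  assumes "\<sigma> \<in> code_Aut (2 * m) A"
  obtains M where "M \<in> carrier_mat m m" "G * perm_mat (2 * m) \<sigma> = M * G"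
proof
  have \<sigma>: "\<sigma> permutes {..<2 * m}" and \<sigma>A: "permute_code \<sigma> A = A"
    using assms unfolding code_Aut_def by auto
  let ?H = "G * perm_mat (2 * m) \<sigma>"
  \<comment> \<open>As \<open>G\<close> is the identity on the information positions, the equation
    to be shown leaves only this choice: the columns \<open>p j\<close> of the permuted
    matrix.\<close>
  let ?M = "mat m m (\<lambda>(i, j). ?H $$ (i, p j))"
  have H: "?H \<in> carrier_mat m (2 * m)" using mult_carrier_mat[OF G perm_mat_carrier] .
  have Gt: "G\<^sup>T \<in> carrier_mat (2 * m) m" by simp
  show M: "?M \<in> carrier_mat m m" by simp
  have "?H\<^sup>T *\<^sub>v c = (?M * G)\<^sup>T *\<^sub>v c" if c: "c \<in> carrier_vec m" for c
  proof -
    have "?H\<^sup>T *\<^sub>v c \<in> A"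
      using c \<sigma>A A_eq unfolding perm_mat_action[OF \<sigma> c] permute_code_def by blast
    then obtain d where d: "d \<in> carrier_vec m" "?H\<^sup>T *\<^sub>v c = G\<^sup>T *\<^sub>v d" using A_eq by blast
    have "d = ?M\<^sup>T *\<^sub>v c"
    proof (rule eq_vecI)
      fix j assume "j < dim_vec (?M\<^sup>T *\<^sub>v c)"
      then have j: "j < m" by simp
      have "d $ j = (?H\<^sup>T *\<^sub>v c) $ p j" using G_T_mult_p[OF d(1) j] d(2) by simp
      also have "\<dots> = col ?H (p j) \<bullet> c" using p_less[OF j] carrier_matD[OF H] by simp
      also have "col ?H (p j) = col ?M j"
        using p_less[OF j] j carrier_matD[OF H] carrier_matD[OF G] by (intro eq_vecI) auto
      finally show "d $ j = (?M\<^sup>T *\<^sub>v c) $ j" using j by simp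
    qed (use d in simp)
    then have "?H\<^sup>T *\<^sub>v c = G\<^sup>T *\<^sub>v (?M\<^sup>T *\<^sub>v c)" using d by simp
    also have "\<dots> = (?M * G)\<^sup>T *\<^sub>v c"
      using transpose_mult[OF M G] assoc_mult_mat_vec[OF Gt _ c, of "?M\<^sup>T"] by simp
    finally show ?thesis .
  qed
  then have "?H\<^sup>T = (?M * G)\<^sup>T"
    using H mult_carrier_mat[OF M G] by (intro eq_mat_if_eq_mult_vec[of _ "2 * m" m]) auto
  then show "?H = ?M * G" by simp
qed

text \<open>Rewrites the matrix action in terms of functionals: \<open>b\<close> lies in the orbit
  of \<open>a\<close> when its functional is that of \<open>a\<close> composed with an automorphism.
  The generator matrix then enters only through \<open>info_vec\<close>.\<close>

lemma Aut_orbit_iff: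
  assumes a: "a \<in> carrier_vec m"
  shows "b \<in> Aut_orbit m A G a \<longleftrightarrow> b \<in> carrier_vec m \<and>
    (\<exists>\<sigma>\<in>code_Aut (2 * m) A. \<forall>g\<in>A. g \<bullet> info_vec m p b = permute_vec \<sigma> g \<bullet> info_vec m p a)"
    (is "?L \<longleftrightarrow> ?R")
proof -
  have Gt: "G\<^sup>T \<in> carrier_mat (2 * m) m" by simp
  \<comment> \<open>Permuting the codeword with message \<open>c\<close> replaces the message by
    \<open>M\<^sup>T *\<^sub>v c\<close>, and transposing moves the matrix over to
    \<open>a\<close>.\<close>
  have act: "permute_vec \<sigma> (G\<^sup>T *\<^sub>v c) \<bullet> info_vec m p a = c \<bullet> (M *\<^sub>v a)"
    if M: "M \<in> carrier_mat m m" "G * perm_mat (2 * m) \<sigma> = M * G"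
      and \<sigma>: "\<sigma> permutes {..<2 * m}" and c: "c \<in> carrier_vec m" for M \<sigma> c
  proof -
    have Mt: "M\<^sup>T \<in> carrier_mat m m" using M by simp
    have "permute_vec \<sigma> (G\<^sup>T *\<^sub>v c) = (M * G)\<^sup>T *\<^sub>v c"
      unfolding perm_mat_action[OF \<sigma> c, symmetric] M(2) ..
    also have "\<dots> = G\<^sup>T *\<^sub>v (M\<^sup>T *\<^sub>v c)"
      using transpose_mult[OF M(1) G] assoc_mult_mat_vec[OF Gt Mt c] by simp
    finally show ?thesis
      using G_T_scalar_prod_info[OF mult_mat_vec_carrier[OF Mt c] a]
        transpose_vec_mult_scalar[OF M(1) a c] by simp
  qed
  show ?thesis
  proof
    assume ?L
    then obtain M \<sigma> where M: "M \<in> carrier_mat m m" "G * perm_mat (2 * m) \<sigma> = M * G"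
      and \<sigma>: "\<sigma> \<in> code_Aut (2 * m) A" and b: "b = M *\<^sub>v a"
      unfolding Aut_orbit_def by blast
    have bc: "b \<in> carrier_vec m" unfolding b using mult_mat_vec_carrier[OF M(1) a] .
    have \<sigma>p: "\<sigma> permutes {..<2 * m}" using \<sigma> unfolding code_Aut_def by blast
    have "g \<bullet> info_vec m p b = permute_vec \<sigma> g \<bullet> info_vec m p a" if g: "g \<in> A" for g
    proof -
      obtain c where c: "c \<in> carrier_vec m" "g = G\<^sup>T *\<^sub>v c" using g A_eq by blast
      then show ?thesis using act[OF M \<sigma>p c(1)] G_T_scalar_prod_info[OF c(1) bc] b by simp
    qed
    then show ?R using bc \<sigma> by blast
  next
    assume ?R
    then obtain \<sigma> where bc: "b \<in> carrier_vec m" and \<sigma>: "\<sigma> \<in> code_Aut (2 * m) A"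
      and eq: "\<And>g. g \<in> A \<Longrightarrow> g \<bullet> info_vec m p b = permute_vec \<sigma> g \<bullet> info_vec m p a" by blast
    let ?\<tau> = "Hilbert_Choice.inv \<sigma>"
    have \<sigma>p: "\<sigma> permutes {..<2 * m}" using \<sigma> unfolding code_Aut_def by blast
    have \<tau>p: "?\<tau> permutes {..<2 * m}" using permutes_inv[OF \<sigma>p] .
    have \<tau>: "?\<tau> \<in> code_Aut (2 * m) A"
      using \<sigma> \<tau>p permute_code_inv[OF \<sigma>p A_carrier] unfolding code_Aut_def by simp
    obtain M where M: "M \<in> carrier_mat m m" "G * perm_mat (2 * m) \<sigma> = M * G"
      using automorphism_matrix[OF \<sigma>] .
    obtain N where N: "N \<in> carrier_mat m m" "G * perm_mat (2 * m) ?\<tau> = N * G"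
      using automorphism_matrix[OF \<tau>] .
    \<comment> \<open>Inverse permutations give inverse matrices, after cancelling \<open>G\<close>.
      Used in both orders, this yields the invertibility demanded by
      \<open>Aut_orbit\<close>.\<close>
    have prod: "X * Y = 1\<^sub>m m"
      if X: "X \<in> carrier_mat m m" "G * perm_mat (2 * m) \<alpha> = X * G"
        and Y: "Y \<in> carrier_mat m m" "G * perm_mat (2 * m) \<beta> = Y * G"
        and perm: "\<alpha> permutes {..<2 * m}" "\<beta> permutes {..<2 * m}" "\<And>i. \<beta> (\<alpha> i) = i"
      for X Y \<alpha> \<beta>
    proof (rule mult_G_cancel)
      have "(X * Y) * G = X * (Y * G)" using assoc_mult_mat[OF X(1) Y(1) G] .
      also have "\<dots> = (X * G) * perm_mat (2 * m) \<beta>"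
        unfolding Y(2)[symmetric] using assoc_mult_mat[OF X(1) G perm_mat_carrier] by simp
      also have "\<dots> = G * (perm_mat (2 * m) \<alpha> * perm_mat (2 * m) \<beta>)"
        unfolding X(2)[symmetric] using assoc_mult_mat[OF G perm_mat_carrier perm_mat_carrier] .
      also have "\<dots> = 1\<^sub>m m * G"
        unfolding perm_mat_mult_inv[OF perm] using right_mult_one_mat[OF G] left_mult_one_mat[OF G] by simp
      finally show "(X * Y) * G = 1\<^sub>m m * G" .
    qed (use X Y in auto)
    have "M * N = 1\<^sub>m m" using prod[OF M N \<sigma>p \<tau>p] permutes_inverses(2)[OF \<sigma>p] by blast
    moreover have "N * M = 1\<^sub>m m" using prod[OF N M \<tau>p \<sigma>p] permutes_inverses(1)[OF \<sigma>p] by blast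
    ultimately have "invertible_mat M"
      using M(1) N(1) unfolding invertible_mat_def inverts_mat_def square_mat.simps
      by (metis carrier_matD)
    moreover have "b = M *\<^sub>v a"
    proof (rule eq_vec_if_eq_scalar_prod)
      fix c :: "bit vec" assume c: "c \<in> carrier_vec m"
      then have "G\<^sup>T *\<^sub>v c \<in> A" using A_eq by blast
      then show "c \<bullet> b = c \<bullet> (M *\<^sub>v a)"
        using eq act[OF M \<sigma>p c] G_T_scalar_prod_info[OF c bc] by simp
    qed (use bc mult_mat_vec_carrier[OF M(1) a] in auto)
    ultimately show ?L using M \<sigma> unfolding Aut_orbit_def by blast
  qed
qed

end

text \<open>What the algorithm needs of Child, freed from the choice of generator matrix and
  representatives: every member is a child of \<open>A\<close>, every child of \<open>A\<close> is
  reached up to a pair-preserving permutation, and no two distinct members are related by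
  one.\<close>

lemma
  assumes A: "dual_code (2 * m) A = A" and S: "is_Child m A S"
  shows is_Child_imp_child_of:
      "B \<in> S \<Longrightarrow> \<exists>w. w \<in> carrier_vec (2 * m) \<and> w \<bullet> w = 1 \<and> B = child_of A w"
    and is_Child_complete:
      "w \<in> carrier_vec (2 * m) \<Longrightarrow> w \<bullet> w = 1 \<Longrightarrow>
        \<exists>\<tau> \<pi>. lifts_perm (2 * m) \<tau> \<pi> \<and> permute_code \<pi> (child_of A w) \<in> S"
    and is_Child_unique:
      "B \<in> S \<Longrightarrow> B' \<in> S \<Longrightarrow> lifts_perm (2 * m) \<sigma> \<pi> \<Longrightarrow> permute_code \<pi> B = B' \<Longrightarrow> B = B'"
proof -
  obtain G p R where gen: "systematic_generator m A G p" and R: "orbit_transversal m A G R"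
    and S_eq: "S = child_code m G p ` R"
    using S unfolding is_Child_def by blast
  interpret systematic m A G p using gen A by unfold_locales
  let ?i = "info_vec m p"
  have R_odd: "a \<in> carrier_vec m" "?i a \<bullet> ?i a = 1" "child_code m G p a = child_of A (?i a)"
    if "a \<in> R" for a
    using that R child_code_eq odd_weight_iff unfolding orbit_transversal_def by blast+
  have ex1: "\<exists>!b. b \<in> R \<and> b \<in> Aut_orbit m A G a" if "a \<in> odd_weight_vecs m" for a
    using that R unfolding orbit_transversal_def by blast
  show "\<exists>w. w \<in> carrier_vec (2 * m) \<and> w \<bullet> w = 1 \<and> B = child_of A w" if "B \<in> S"
    using that R_odd info_vec_carrier unfolding S_eq by blast
  show "\<exists>\<tau> \<pi>. lifts_perm (2 * m) \<tau> \<pi> \<and> permute_code \<pi> (child_of A w) \<in> S"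
    if w: "w \<in> carrier_vec (2 * m)" "w \<bullet> w = 1"
  proof -
    have odd: "G *\<^sub>v w \<in> odd_weight_vecs m" using info_vec_of_functional(2)[OF w] .
    then have "G *\<^sub>v w \<in> carrier_vec m" using odd_weight_iff by blast
    then obtain b \<sigma> where b: "b \<in> R" and \<sigma>: "\<sigma> \<in> code_Aut (2 * m) A"
      and eq: "\<And>g. g \<in> A \<Longrightarrow> g \<bullet> ?i b = permute_vec \<sigma> g \<bullet> ?i (G *\<^sub>v w)"
      using ex1[OF odd] Aut_orbit_iff by blast
    \<comment> \<open>The orbit relation expresses the functional of \<open>b\<close> through that
      of \<open>w\<close>; carrying the child of \<open>w\<close> to the child of \<open>b\<close>
      needs the opposite direction.\<close>
    let ?\<tau> = "Hilbert_Choice.inv \<sigma>"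
    have \<sigma>p: "\<sigma> permutes {..<2 * m}" and \<sigma>A: "permute_code \<sigma> A = A"
      using \<sigma> unfolding code_Aut_def by auto
    have \<tau>A: "permute_code ?\<tau> A = A"
      using permute_code_inv[OF \<sigma>p A_carrier] \<sigma>A by simp
    have "g \<bullet> w = permute_vec ?\<tau> g \<bullet> ?i b" if g: "g \<in> A" for g
    proof -
      have "permute_vec ?\<tau> g \<in> A" using g \<tau>A unfolding permute_code_def by blast
      then show ?thesis
        using eq permute_vec_inv(2)[OF \<sigma>p] g A_carrier info_vec_of_functional(1)[OF w(1) g] by force
    qed
    then show ?thesis
      using child_of_equiv[OF A A w info_vec_carrier permutes_inv[OF \<sigma>p] \<tau>A] R_odd(3)[OF b] b
      unfolding S_eq by (metis image_eqI)
  qed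
  show "B = B'" if B: "B \<in> S" "B' \<in> S" and l: "lifts_perm (2 * m) \<sigma> \<pi>" and eq: "permute_code \<pi> B = B'"
  proof -
    obtain a a' where a: "a \<in> R" "B = child_code m G p a" and a': "a' \<in> R" "B' = child_code m G p a'"
      using B unfolding S_eq by blast
    have eq': "permute_code \<pi> (child_of A (?i a)) = child_of A (?i a')"
      using eq a a' R_odd(3) by simp
    note imp = child_of_equiv_imp[OF A A info_vec_carrier info_vec_carrier l eq']
    have \<sigma>: "\<sigma> \<in> code_Aut (2 * m) A" using imp(1) l unfolding code_Aut_def lifts_perm_def by blast
    have id: "id \<in> code_Aut (2 * m) A" unfolding code_Aut_def by (simp add: permutes_id)
    \<comment> \<open>Both representatives lie in the orbit of \<open>a'\<close>, \<open>a'\<close>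
      itself through the identity, so uniqueness in the transversal identifies them.\<close>
    have "a \<in> Aut_orbit m A G a'"
      using Aut_orbit_iff[OF R_odd(1)[OF a'(1)]] R_odd(1)[OF a(1)] imp(2) \<sigma> by blast
    moreover have "a' \<in> Aut_orbit m A G a'"
      using Aut_orbit_iff[OF R_odd(1)[OF a'(1)]] R_odd(1)[OF a'(1)] id permute_vec_id by metis
    ultimately have "a = a'"
      using ex1[of a'] a(1) a'(1) R_odd[OF a'(1)] odd_weight_iff by blast
    then show ?thesis using a a' by simp
  qed
qed

subsection \<open>One augmentation step\<close>

lemma self_dual_codes_carrier: "C \<in> self_dual_codes k \<Longrightarrow> C \<subseteq> carrier_vec (2 * k)"
  using self_dual_carrier self_dual_codes_iff by blast

lemma child_of_self_dual_codes:
  assumes A: "A \<in> self_dual_codes m" and w: "w \<in> carrier_vec (2 * m)" "w \<bullet> w = 1"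
  shows "child_of A w \<in> self_dual_codes (Suc m)"
proof -
  have "card (child_of A w) = 2 ^ Suc m"
    using card_child_of[OF self_dual_codes_carrier[OF A] w(1)] A self_dual_codes_iff by simp
  then show ?thesis
    using A child_of_self_dual[of "2 * m" A w] w by (simp add: self_dual_codes_iff)
qed

lemma pair_comp:
  assumes "{\<alpha> a, \<alpha> b} = {a, b}" "{\<beta> a, \<beta> b} = {a, b}"
  shows "{(\<alpha> \<circ> \<beta>) a, (\<alpha> \<circ> \<beta>) b} = {a, b}"
  using assms by (auto simp: doubleton_eq_iff)

lemma pair_inv:
  assumes "bij \<alpha>" "{\<alpha> a, \<alpha> b} = {a, b}"
  shows "{Hilbert_Choice.inv \<alpha> a, Hilbert_Choice.inv \<alpha> b} = {a, b}"
  using assms(2) inv_f_f[OF bij_is_inj[OF assms(1)], of a] inv_f_f[OF bij_is_inj[OF assms(1)], of b]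
  by (auto simp: doubleton_eq_iff)

text \<open>Composing an automorphism of \<open>B\<close> with the inverse of \<open>\<phi>\<close>
  gives a permutation carrying the canonical form to \<open>B\<close>, and conversely. The tested
  coordinates are the preimages of the last pair under \<open>\<phi>\<close>, so the test asks that
  this permutation preserve the pair; the choice of \<open>\<phi>\<close> drops out.\<close>

lemma passes_parent_test_iff:
  assumes B: "B \<in> self_dual_codes (Suc m)" and \<phi>: "canonical_perm (Suc m) \<rho> B \<phi>"
  shows "passes_parent_test (Suc m) \<phi> B \<longleftrightarrow>
    (\<exists>\<pi>. \<pi> permutes {..<2 * m + 2} \<and> {\<pi> (2 * m), \<pi> (Suc (2 * m))} = {2 * m, Suc (2 * m)} \<and>
      permute_code \<pi> (\<rho> B) = B)"
    (is "_ \<longleftrightarrow> ?R")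
proof -
  let ?i = "Hilbert_Choice.inv \<phi>"
  have \<phi>p: "\<phi> permutes {..<2 * m + 2}" and \<phi>B: "permute_code \<phi> B = \<rho> B"
    using \<phi> unfolding canonical_perm_def by simp_all
  have Bc: "B \<subseteq> carrier_vec (2 * m + 2)" using self_dual_codes_carrier[OF B] by simp
  have test: "passes_parent_test (Suc m) \<phi> B \<longleftrightarrow> (\<exists>\<sigma>. \<sigma> permutes {..<2 * m + 2} \<and>
      permute_code \<sigma> B = B \<and> {\<sigma> (?i (2 * m)), \<sigma> (?i (Suc (2 * m)))} = {2 * m, Suc (2 * m)})"
    unfolding passes_parent_test_def code_Aut_def by (auto simp: insert_commute)
  show ?thesis
  proof
    assume "passes_parent_test (Suc m) \<phi> B"
    then obtain \<sigma> where \<sigma>: "\<sigma> permutes {..<2 * m + 2}" "permute_code \<sigma> B = B"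
      and pair: "{\<sigma> (?i (2 * m)), \<sigma> (?i (Suc (2 * m)))} = {2 * m, Suc (2 * m)}"
      unfolding test by blast
    have "permute_code (\<sigma> \<circ> ?i) (\<rho> B) = permute_code \<sigma> (permute_code ?i (permute_code \<phi> B))"
      unfolding \<phi>B[symmetric]
      by (rule permute_code_comp[OF \<sigma>(1) permutes_inv[OF \<phi>p] permute_code_carrier[OF Bc]])
    also have "\<dots> = B" using permute_code_inv[OF \<phi>p Bc] \<sigma>(2) by simp
    finally have "permute_code (\<sigma> \<circ> ?i) (\<rho> B) = B" .
    then show ?R using permutes_compose[OF permutes_inv[OF \<phi>p] \<sigma>(1)] pair
      by (intro exI[of _ "\<sigma> \<circ> ?i"]) simp
  next
    assume ?R
    then obtain \<pi> where \<pi>: "\<pi> permutes {..<2 * m + 2}" "permute_code \<pi> (\<rho> B) = B"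
      and pair: "{\<pi> (2 * m), \<pi> (Suc (2 * m))} = {2 * m, Suc (2 * m)}" by blast
    have "permute_code (\<pi> \<circ> \<phi>) B = B"
      using permute_code_comp[OF \<pi>(1) \<phi>p Bc] \<phi>B \<pi>(2) by simp
    moreover have "{(\<pi> \<circ> \<phi>) (?i (2 * m)), (\<pi> \<circ> \<phi>) (?i (Suc (2 * m)))} = {2 * m, Suc (2 * m)}"
      using pair permutes_inverses(1)[OF \<phi>p] by simp
    ultimately show "passes_parent_test (Suc m) \<phi> B"
      unfolding test using permutes_compose[OF \<phi>p \<pi>(1)] by blast
  qed
qed

text \<open>For uniqueness, an equivalence respecting the appended pair is obtained through the
  canonical form and descends to the parents. Existence starts from the canonical form rather than
  the given code, because its last two coordinates are known to differ.\<close>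

lemma augmentation_step:
  assumes \<rho>: "canonical_rep_map (Suc m) \<rho>"
    and \<phi>: "\<And>B. B \<in> self_dual_codes (Suc m) \<Longrightarrow> canonical_perm (Suc m) \<rho> B (\<phi> B)"
    and Child: "\<And>A. A \<in> self_dual_codes m \<Longrightarrow> is_Child m A (Child A)"
    and U: "all_inequivalent_self_dual m U"
  shows "all_inequivalent_self_dual (Suc m)
    (\<Union>A\<in>U. {B \<in> Child A. passes_parent_test (Suc m) (\<phi> B) B})" (is "all_inequivalent_self_dual _ ?U'")
proof -
  let ?n = "2 * m"
  have n2: "2 * Suc m = ?n + 2" by simp
  have U_sd: "A \<in> self_dual_codes m" if "A \<in> U" for A
    using U that unfolding all_inequivalent_self_dual_def by blast
  have U_ex: "\<exists>D\<in>U. code_equiv ?n C D" if "C \<in> self_dual_codes m" for C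
    using U that unfolding all_inequivalent_self_dual_def by blast
  have U_eq: "D = D'" if "D \<in> U" "D' \<in> U" "code_equiv ?n D D'" for D D'
    using U that U_sd code_equiv_refl unfolding all_inequivalent_self_dual_def by blast
  have sd: "dual_code ?n A = A" "card A = 2 ^ m" "is_Child m A (Child A)" if "A \<in> self_dual_codes m" for A
    using that Child self_dual_codes_iff by blast+
  have sd': "dual_code (?n + 2) B = B" "card B = 2 ^ Suc m" "B \<subseteq> carrier_vec (?n + 2)"
    if "B \<in> self_dual_codes (Suc m)" for B
    using that self_dual_codes_iff[of B "Suc m"] self_dual_codes_carrier[OF that] by simp_all
  have \<rho>_sd: "\<rho> B \<in> self_dual_codes (Suc m)" "code_equiv (?n + 2) (\<rho> B) B"
    "\<not> equal_coords (\<rho> B) ?n (Suc ?n)" if "B \<in> self_dual_codes (Suc m)" for B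
    using \<rho> that unfolding canonical_rep_map_def by auto
  have \<rho>_eq: "\<rho> B = \<rho> B'"
    if "B \<in> self_dual_codes (Suc m)" "B' \<in> self_dual_codes (Suc m)" "code_equiv (?n + 2) B B'" for B B'
    using \<rho> that unfolding canonical_rep_map_def n2 by blast
  have U': "\<exists>A w. A \<in> U \<and> B \<in> Child A \<and> w \<in> carrier_vec ?n \<and> w \<bullet> w = 1 \<and> B = child_of A w \<and>
      B \<in> self_dual_codes (Suc m) \<and> passes_parent_test (Suc m) (\<phi> B) B" if B: "B \<in> ?U'" for B
  proof -
    obtain A where A: "A \<in> U" "B \<in> Child A" and test: "passes_parent_test (Suc m) (\<phi> B) B"
      using B by blast
    then obtain w where "w \<in> carrier_vec ?n" "w \<bullet> w = 1" "B = child_of A w"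
      using is_Child_imp_child_of[OF sd(1,3)] U_sd by blast
    then show ?thesis using A test child_of_self_dual_codes[OF U_sd[OF A(1)]] by blast
  qed
  have unique: "B = B'" if B: "B \<in> ?U'" and B': "B' \<in> ?U'" and equiv: "code_equiv (?n + 2) B B'" for B B'
  proof -
    obtain A w where A: "A \<in> U" "B \<in> Child A" and w: "w \<in> carrier_vec ?n" "B = child_of A w"
      and Bsd: "B \<in> self_dual_codes (Suc m)" and Bt: "passes_parent_test (Suc m) (\<phi> B) B"
      using U'[OF B] by blast
    obtain A' w' where A': "A' \<in> U" "B' \<in> Child A'" and w': "w' \<in> carrier_vec ?n" "B' = child_of A' w'"
      and Bsd': "B' \<in> self_dual_codes (Suc m)" and Bt': "passes_parent_test (Suc m) (\<phi> B') B'"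
      using U'[OF B'] by blast
    obtain \<alpha> where \<alpha>: "\<alpha> permutes {..<?n + 2}" "{\<alpha> ?n, \<alpha> (Suc ?n)} = {?n, Suc ?n}"
      "permute_code \<alpha> (\<rho> B) = B"
      using Bt passes_parent_test_iff[OF Bsd \<phi>[OF Bsd]] by blast
    obtain \<beta> where \<beta>: "\<beta> permutes {..<?n + 2}" "{\<beta> ?n, \<beta> (Suc ?n)} = {?n, Suc ?n}"
      "permute_code \<beta> (\<rho> B') = B'"
      using Bt' passes_parent_test_iff[OF Bsd' \<phi>[OF Bsd']] by blast
    \<comment> \<open>Equivalent codes share their canonical form, so the two witnesses of the
      parent test compose to a map from \<open>B\<close> to \<open>B'\<close> that preserves the
      pair.\<close>
    let ?\<pi> = "\<beta> \<circ> Hilbert_Choice.inv \<alpha>"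
    have \<rho>c: "\<rho> B \<subseteq> carrier_vec (?n + 2)" using sd'(3) \<rho>_sd(1) Bsd by blast
    have "permute_code ?\<pi> B = permute_code \<beta> (permute_code (Hilbert_Choice.inv \<alpha>) B)"
      using permute_code_comp[OF \<beta>(1) permutes_inv[OF \<alpha>(1)] sd'(3)[OF Bsd]] .
    also have "permute_code (Hilbert_Choice.inv \<alpha>) B = \<rho> B"
      using permute_code_inv[OF \<alpha>(1) \<rho>c] \<alpha>(3) by simp
    also have "\<rho> B = \<rho> B'" using \<rho>_eq[OF Bsd Bsd' equiv] .
    also have "permute_code \<beta> (\<rho> B') = B'" by (rule \<beta>(3))
    finally have \<pi>B: "permute_code ?\<pi> B = B'" .
    obtain \<sigma> where l: "lifts_perm ?n \<sigma> ?\<pi>"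
      using lifts_perm_exists[OF permutes_compose[OF permutes_inv[OF \<alpha>(1)] \<beta>(1)]
          pair_comp[OF \<beta>(2) pair_inv[OF permutes_bij[OF \<alpha>(1)] \<alpha>(2)]]] by blast
    have "permute_code \<sigma> A = A'"
      using child_of_equiv_imp(1)[OF sd(1) sd(1) w(1) w'(1) l] U_sd A A' \<pi>B w(2) w'(2) by blast
    then have "code_equiv ?n A A'" using l unfolding code_equiv_def lifts_perm_def by blast
    then have "A = A'" using U_eq A A' by blast
    then show ?thesis using is_Child_unique[OF sd(1,3) A(2) _ l \<pi>B] A A' U_sd by blast
  qed
  have ex: "\<exists>B\<in>?U'. code_equiv (?n + 2) C B" if C: "C \<in> self_dual_codes (Suc m)" for C
  proof -
    let ?R = "\<rho> C"
    let ?A = "shortened ?n ?R"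
    note R = sd'[OF \<rho>_sd(1)[OF C]]
    obtain w \<pi>0 where w: "w \<in> carrier_vec ?n" "w \<bullet> w = 1" and A: "dual_code ?n ?A = ?A"
      and l0: "lifts_perm ?n id \<pi>0" and \<pi>0: "permute_code \<pi>0 ?R = child_of ?A w"
      using self_dual_imp_child_of[OF R(1) \<rho>_sd(3)[OF C]] by blast
    have "?A \<subseteq> carrier_vec ?n" unfolding shortened_def by blast
    \<comment> \<open>The canonical form is a permuted child of \<open>?A\<close>, so its size is
      twice that of the parent, which fixes the dimension of the parent as \<open>m\<close>.\<close>
    then have "2 * card ?A = 2 ^ Suc m"
      using card_child_of[of ?A ?n w] permute_code_card[OF lifts_perm_permutes[OF l0] R(3)]
        w R(2) \<pi>0 by simp
    then have "?A \<in> self_dual_codes m" using A self_dual_codes_iff by simp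
    then obtain D \<sigma> where D: "D \<in> U" and \<sigma>: "\<sigma> permutes {..<?n}" "permute_code \<sigma> ?A = D"
      using U_ex unfolding code_equiv_def by blast
    \<comment> \<open>Transporting \<open>w\<close> along with the parent keeps the functional
      compatible with \<open>\<sigma>\<close>, as the correspondence of children requires.\<close>
    let ?w = "permute_vec \<sigma> w"
    have w': "?w \<in> carrier_vec ?n" "?w \<bullet> ?w = 1"
      using w permute_vec_scalar_prod[OF \<sigma>(1)] by simp_all
    have "g \<bullet> w = permute_vec \<sigma> g \<bullet> ?w" if "g \<in> ?A" for g
      using permute_vec_scalar_prod[OF \<sigma>(1) self_dual_carrier[OF A that] w(1)] by simp
    then obtain \<tau>1 \<pi>1 where l1: "lifts_perm ?n \<tau>1 \<pi>1"
      and \<pi>1: "permute_code \<pi>1 (child_of ?A w) = child_of D ?w"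
      using child_of_equiv[OF A sd(1)[OF U_sd[OF D]] w w'(1) \<sigma>] by blast
    obtain \<tau>2 \<pi>2 where l2: "lifts_perm ?n \<tau>2 \<pi>2"
      and \<pi>2: "permute_code \<pi>2 (child_of D ?w) \<in> Child D"
      using is_Child_complete[OF sd(1,3) w'] U_sd D by blast
    let ?B = "permute_code \<pi>2 (child_of D ?w)"
    let ?\<pi> = "\<pi>2 \<circ> (\<pi>1 \<circ> \<pi>0)"
    note p0 = lifts_perm_permutes[OF l0] lifts_perm_pair[OF l0]
    note p1 = lifts_perm_permutes[OF l1] lifts_perm_pair[OF l1]
    note p2 = lifts_perm_permutes[OF l2] lifts_perm_pair[OF l2]
    have p10: "\<pi>1 \<circ> \<pi>0 permutes {..<?n + 2}" using permutes_compose[OF p0(1) p1(1)] .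
    have \<pi>: "?\<pi> permutes {..<?n + 2}" using permutes_compose[OF p10 p2(1)] .
    have \<pi>B: "permute_code ?\<pi> ?R = ?B"
      unfolding permute_code_comp[OF p2(1) p10 R(3)] permute_code_comp[OF p1(1) p0(1) R(3)] \<pi>0 \<pi>1 ..
    obtain w2 where "w2 \<in> carrier_vec ?n" "w2 \<bullet> w2 = 1" "?B = child_of D w2"
      using is_Child_imp_child_of[OF sd(1,3) \<pi>2] U_sd D by blast
    then have Bsd: "?B \<in> self_dual_codes (Suc m)"
      using child_of_self_dual_codes[OF U_sd[OF D]] by simp
    have "code_equiv (?n + 2) ?R ?B" using \<pi> \<pi>B unfolding code_equiv_def by blast
    then have CB: "code_equiv (?n + 2) C ?B"
      using code_equiv_trans[OF code_equiv_sym[OF \<rho>_sd(2)[OF C] R(3)]] sd'(3)[OF C] by blast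
    \<comment> \<open>The code \<open>?B\<close> has the canonical form from which the construction
      began, so the composed pair-preserving permutation is itself the witness for the parent
      test.\<close>
    have "permute_code ?\<pi> (\<rho> ?B) = ?B" using \<rho>_eq[OF C Bsd CB] \<pi>B by simp
    then have "passes_parent_test (Suc m) (\<phi> ?B) ?B"
      using passes_parent_test_iff[OF Bsd \<phi>[OF Bsd]] \<pi>
        pair_comp[OF p2(2) pair_comp[OF p1(2) p0(2)]] by blast
    then show ?thesis using D \<pi>2 CB by blast
  qed
  show ?thesis
    unfolding all_inequivalent_self_dual_def n2
  proof (intro conjI ballI)
    show "?U' \<subseteq> self_dual_codes (Suc m)" using U' by blast
    fix C assume C: "C \<in> self_dual_codes (Suc m)"
    then obtain B where B: "B \<in> ?U'" "code_equiv (?n + 2) C B" using ex by blast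
    show "\<exists>!D. D \<in> ?U' \<and> code_equiv (?n + 2) C D"
    proof (rule ex1I)
      show "B \<in> ?U' \<and> code_equiv (?n + 2) C B" using B by blast
      fix D assume D: "D \<in> ?U' \<and> code_equiv (?n + 2) C D"
      have "code_equiv (?n + 2) D B"
        using D B code_equiv_trans code_equiv_sym sd'(3)[OF C] U' sd'(3) by meson
      then show "D = B" using unique D B by blast
    qed
  qed
qed

text \<open>Unfolding one recursive call for every input code turns the depth-first recursion into
  processing by levels, so that the augmentation step can be applied to a whole list.\<close>

lemma algorithm_output_Suc:
  assumes "m < k"
  shows "algorithm_output Child \<phi> k m U = algorithm_output Child \<phi> k (Suc m)
    (\<Union>A\<in>U. {B \<in> Child A. passes_parent_test (Suc m) (\<phi> B) B})"
proof -
  have "augmentation Child \<phi> k m A =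
      (\<Union>B\<in>{B \<in> Child A. passes_parent_test (Suc m) (\<phi> B) B}. augmentation Child \<phi> k (Suc m) B)" for A
    using assms by (simp add: augmentation.simps[of _ _ k m])
  then show ?thesis unfolding algorithm_output_def by simp
qed

theorem corollary10:
  fixes r k :: nat
    and \<rho> :: "nat \<Rightarrow> code \<Rightarrow> code"
    and \<phi> :: "code \<Rightarrow> nat \<Rightarrow> nat"
    and Child :: "code \<Rightarrow> code set"
    and U :: "code set"
  assumes "1 \<le> r" and "r < k"
    and "\<And>m. 2 \<le> m \<Longrightarrow> canonical_rep_map m (\<rho> m)"
    and "\<And>m B. 2 \<le> m \<Longrightarrow> B \<in> self_dual_codes m \<Longrightarrow> canonical_perm m (\<rho> m) B (\<phi> B)"
    and "\<And>m A. 1 \<le> m \<Longrightarrow> A \<in> self_dual_codes m \<Longrightarrow> is_Child m A (Child A)"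
    and "all_inequivalent_self_dual r U"
  shows "all_inequivalent_self_dual k (algorithm_output Child \<phi> k r U)"
proof -
  have "r \<le> k" using assms(2) by simp
  then show ?thesis using assms(1,6)
  \<comment> \<open>The list varies because each level starts from the accepted children of the
    previous one. The bound \<open>1 \<le> r\<close> is kept in the induction so that children have
    dimension at least 2, where canonical forms are given.\<close>
  proof (induction r arbitrary: U rule: inc_induct)
    case base
    have "algorithm_output Child \<phi> k k U = U"
      unfolding algorithm_output_def by (simp add: augmentation.simps)
    then show ?case using base by simp
  next
    case (step m)
    have "all_inequivalent_self_dual (Suc m)
        (\<Union>A\<in>U. {B \<in> Child A. passes_parent_test (Suc m) (\<phi> B) B})"
      using step.prems by (intro augmentation_step[of m "\<rho> (Suc m)"] assms(3-5)) simp_all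
    then show ?case
      using step.IH algorithm_output_Suc[OF step.hyps(2)] by simp
  qed
qed

end
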